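(* Let $n\geq 2$. A continuous, translation invariant Minkowski valuation $\Phi:\mathcal{K}^n\to\mathcal{K}^n$ with origin-symmetric images satisfies (VC) and $\dim(\Phi(\{0\}))=n-1$ if and only if there exist an origin-symmetric $L\in\mathcal{K}^n$ with $\dim L=n-1$ and a segment $S$ centered at the origin with $\dim(L+S)=n$ such that $\Phi(K)=L+V_n(K)S$ for all $K\in\mathcal{K}^n$.
   Context: $\mathcal{K}^n$ is the space of convex bodies in $\mathbb{R}^n$ with Hausdorff metric and Minkowski addition. A Minkowski valuation satisfies $\Phi(K)+\Phi(L)=\Phi(K\cup L)+\Phi(K\cap L)$ whenever $K,L,K\cup L\in\mathcal{K}^n$; translation invariant means $\Phi(K+t)=\Phi(K)$; origin-symmetric means $M=-M$. (VC): there are $c,C>0$ with $cV_n(K)\le V_n(\Phi(K))\le CV_n(K)$ for all $K$. $\dim$ is the dimension of the affine hull. *)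

theory Defs
  imports "HOL-Analysis.Analysis"
begin

definition convex_body :: "'a::euclidean_space set \<Rightarrow> bool" where
  "convex_body K \<longleftrightarrow> K \<noteq> {} \<and> compact K \<and> convex K"

definition msum :: "'a::euclidean_space set \<Rightarrow> 'a set \<Rightarrow> 'a set" (infixl "\<oplus>" 65) where
  "A \<oplus> B = {x + y | x y. x \<in> A \<and> y \<in> B}"

definition vol :: "'a::euclidean_space set \<Rightarrow> real" where
  "vol K = measure lebesgue K"

definition origin_symmetric :: "'a::euclidean_space set \<Rightarrow> bool" where
  "origin_symmetric M \<longleftrightarrow> uminus ` M = M"

text \<open>Hausdorff distance (used for nonempty compact sets).\<close>
definition hausdist :: "'a::euclidean_space set \<Rightarrow> 'a set \<Rightarrow> real" where
  "hausdist A B = max (SUP x\<in>A. infdist x B) (SUP y\<in>B. infdist y A)"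

definition hausdorff_continuous :: "('a::euclidean_space set \<Rightarrow> 'a set) \<Rightarrow> bool" where
  "hausdorff_continuous \<Phi> \<longleftrightarrow>
     (\<forall>K. convex_body K \<longrightarrow> (\<forall>e>0. \<exists>d>0. \<forall>L. convex_body L \<and> hausdist K L < d
        \<longrightarrow> hausdist (\<Phi> K) (\<Phi> L) < e))"

definition minkowski_valuation :: "('a::euclidean_space set \<Rightarrow> 'a set) \<Rightarrow> bool" where
  "minkowski_valuation \<Phi> \<longleftrightarrow>
     (\<forall>K L. convex_body K \<and> convex_body L \<and> convex_body (K \<union> L) \<longrightarrow>
        \<Phi> K \<oplus> \<Phi> L = \<Phi> (K \<union> L) \<oplus> \<Phi> (K \<inter> L))"

definition translation_invariant :: "('a::euclidean_space set \<Rightarrow> 'a set) \<Rightarrow> bool" where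
  "translation_invariant \<Phi> \<longleftrightarrow>
     (\<forall>K t. convex_body K \<longrightarrow> \<Phi> ((\<lambda>x. x + t) ` K) = \<Phi> K)"

definition VC :: "('a::euclidean_space set \<Rightarrow> 'a set) \<Rightarrow> bool" where
  "VC \<Phi> \<longleftrightarrow> (\<exists>c C. c > 0 \<and> C > 0 \<and> (\<forall>K. convex_body K \<longrightarrow>
       c * vol K \<le> vol (\<Phi> K) \<and> vol (\<Phi> K) \<le> C * vol K))"

end

theory Submission
  imports Defs "HOL-Library.Set_Algebras"
begin

text \<open>
  For a fixed direction \<open>x\<close>, the support function \<open>h x K\<close> of \<open>\<Phi> K\<close> at \<open>x\<close> is a nonnegative translation
  invariant valuation, so \<open>h x (K + [0, s a])\<close> is affine in \<open>s \<ge> 0\<close>. On parallelotopes this and (VC) force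
  \<open>\<Phi> P = L + vol P [-v, v]\<close>, since any further term would make the volume of \<open>\<Phi> P\<close> grow too fast.
  To pass from parallelotopes to simplices one dissects \<open>2 T\<close> and prisms over simplices \<open>T\<close>. The defect
  \<open>\<mu> T\<close> between \<open>h x\<close> and its expected value satisfies \<open>\<mu> (2 T) = 2 \<mu> T\<close>, and the defects of the simplices
  forming a prism sum to zero, so it suffices to know the sign of \<open>\<mu>\<close>. For \<open>x\<close> orthogonal to \<open>v\<close> it comes from
  \<open>h x \<ge> 0\<close> under scaling up, for the normal \<open>u\<close> of \<open>L\<close> from \<open>h u \<ge> 0\<close> and \<open>vol (r T) = O(r\<^sup>2)\<close> under scaling
  down; these two cases give \<open>\<Phi> T \<subseteq> L + vol T [-v, v]\<close>, which is the sign for all other \<open>x\<close>. Radon's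
  theorem extends the identity from simplices to polytopes, and continuity to all convex bodies.
\<close>

section \<open>Minkowski sums and real-valued valuations\<close>

text \<open>Vanishing on all zonotopes does not force a translation invariant valuation to vanish on
  simplices. In the plane, with a triangle M and mixed areas V, the valuation K -> V(K, M) - V(-K,
  M) is zero on centrally symmetric bodies but not on M, and it doubles when K is doubled. So the
  dissection identities have to be complemented by inequalities, which come from the nonnegativity
  of support functions and from (VC). This dictates the order of the directions: for a general x the
  inequality comes from an inclusion of bodies, and that inclusion needs the exact values at u and
  at all directions orthogonal to v. Cutting 2 T also produces sums of lower-dimensional simplices.
  Therefore the induction runs over Minkowski sums of simplices, and every cut is made in the
  presence of a fixed summand R.\<close>

lemma msum_conv_set_plus: "A \<oplus> B = A + B"
  by (auto simp: msum_def set_plus_def)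

lemma msum_assoc: "(A \<oplus> B) \<oplus> C = A \<oplus> (B \<oplus> C)"
  by (simp add: msum_conv_set_plus add.assoc)

lemma msum_commute: "A \<oplus> B = B \<oplus> A"
  by (simp add: msum_conv_set_plus add.commute)

lemma msum_left_commute: "A \<oplus> (B \<oplus> C) = B \<oplus> (A \<oplus> C)"
  by (metis msum_assoc msum_commute)

lemma msum_zero [simp]: "A \<oplus> {0} = A" "{0} \<oplus> A = A"
  by (auto simp: msum_def)

lemma msum_singleton: "A \<oplus> {t} = (\<lambda>x. x + t) ` A"
  by (auto simp: msum_def)

lemma msum_mono: "A \<subseteq> A' \<Longrightarrow> B \<subseteq> B' \<Longrightarrow> A \<oplus> B \<subseteq> A' \<oplus> B'"
  by (auto simp: msum_def)

lemma msum_Un: "A \<oplus> (B \<union> C) = (A \<oplus> B) \<union> (A \<oplus> C)"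
  by (auto simp: msum_def)

lemma msumI: "a \<in> A \<Longrightarrow> b \<in> B \<Longrightarrow> a + b \<in> A \<oplus> B"
  by (auto simp: msum_def)

lemma convex_hull_msum: "convex hull (A \<oplus> B) = (convex hull A) \<oplus> (convex hull B)"
  by (simp add: msum_conv_set_plus convex_hull_set_plus)

lemma convex_body_msum [simp, intro]:
  assumes "convex_body A" "convex_body B"
  shows "convex_body (A \<oplus> B)"
  using assms convex_set_plus[of A B] compact_sums[of A B]
  by (auto simp: convex_body_def msum_conv_set_plus[symmetric] msum_def)

lemma convex_body_singleton [simp]: "convex_body {x}"
  by (simp add: convex_body_def)

lemma convex_body_closed_segment [simp]: "convex_body (closed_segment a b)"
  by (simp add: convex_body_def)

lemma convex_body_hull: "finite A \<Longrightarrow> A \<noteq> {} \<Longrightarrow> convex_body (convex hull A)"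
  by (simp add: convex_body_def finite_imp_compact_convex_hull)

lemma convex_body_Int_nonempty:
  assumes "convex_body K" "convex_body L" "convex (K \<union> L)"
  shows "K \<inter> L \<noteq> {}"
proof -
  have "connected (K \<union> L)" using assms(3) convex_connected by blast
  moreover have "closed K" "closed L" "K \<noteq> {}" "L \<noteq> {}"
    using assms(1,2) by (simp_all add: convex_body_def compact_imp_closed)
  ultimately show ?thesis
    using connected_closedD[of "K \<union> L" K L] by blast
qed

lemma convex_body_Int:
  assumes "convex_body K" "convex_body L" "convex (K \<union> L)"
  shows "convex_body (K \<inter> L)"
  using assms convex_body_Int_nonempty[OF assms]
  by (auto simp: convex_body_def convex_Int compact_Int)

lemma convex_body_Un:
  assumes "convex_body K" "convex_body L" "convex (K \<union> L)"
  shows "convex_body (K \<union> L)"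
  using assms by (auto simp: convex_body_def)

text \<open>If k + a = k' + b, the segment from a to b stays in the union of A and B and, being
  connected, contains a point c of both. Dividing the segment from k to k' in the same ratio gives
  the element of K that goes with c.\<close>

lemma msum_Int:
  assumes "convex K" "convex_body A" "convex_body B" "convex (A \<union> B)"
  shows "(K \<oplus> A) \<inter> (K \<oplus> B) = K \<oplus> (A \<inter> B)"
proof (intro equalityI subsetI)
  fix z assume "z \<in> (K \<oplus> A) \<inter> (K \<oplus> B)"
  then obtain k a k' b where h: "k \<in> K" "a \<in> A" "z = k + a" "k' \<in> K" "b \<in> B" "z = k' + b"
    by (auto simp: msum_def)
  have sub: "closed_segment a b \<subseteq> A \<union> B"
    using h assms(4) by (intro closed_segment_subset) auto
  have un: "(closed_segment a b \<inter> A) \<union> (closed_segment a b \<inter> B) = closed_segment a b"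
    using sub by auto
  have "closed_segment a b \<inter> A \<inter> (closed_segment a b \<inter> B) \<noteq> {}"
    by (rule convex_body_Int_nonempty)
      (use h assms(2,3) un in \<open>auto simp: convex_body_def convex_Int compact_Int\<close>)
  then obtain c where c: "c \<in> closed_segment a b" "c \<in> A" "c \<in> B" by auto
  then obtain t where t: "0 \<le> t" "t \<le> 1" "c = (1 - t) *\<^sub>R a + t *\<^sub>R b"
    by (auto simp: in_segment)
  have "(1 - t) *\<^sub>R k + t *\<^sub>R k' \<in> K"
    using assms(1) h t by (simp add: convexD_alt)
  moreover have "z = (1 - t) *\<^sub>R z + t *\<^sub>R z"
    by (simp add: scaleR_left_diff_distrib)
  then have "z = (1 - t) *\<^sub>R (k + a) + t *\<^sub>R (k' + b)" using h(3,6) by simp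
  then have "z = ((1 - t) *\<^sub>R k + t *\<^sub>R k') + c"
    unfolding t(3) by (simp only: scaleR_right_distrib add.assoc add.left_commute)
  ultimately show "z \<in> K \<oplus> (A \<inter> B)"
    using c msumI[of _ K c "A \<inter> B"] by (metis IntI)
qed (auto simp: msum_def)

text \<open>Translation invariance is built in because the pieces of a dissection are identified
  only up to translation.\<close>

definition real_valuation :: "('a::euclidean_space set \<Rightarrow> real) \<Rightarrow> bool" where
  "real_valuation f \<longleftrightarrow>
     (\<forall>K L. convex_body K \<and> convex_body L \<and> convex (K \<union> L) \<longrightarrow> f K + f L = f (K \<union> L) + f (K \<inter> L)) \<and>
     (\<forall>K t. convex_body K \<longrightarrow> f ((\<lambda>x. x + t) ` K) = f K)"

lemma real_valuationD:
  assumes "real_valuation f" "convex_body K" "convex_body L" "convex (K \<union> L)"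
  shows "f K + f L = f (K \<union> L) + f (K \<inter> L)"
  using assms by (auto simp: real_valuation_def)

lemma real_valuation_translation:
  "real_valuation f \<Longrightarrow> convex_body K \<Longrightarrow> f (K \<oplus> {t}) = f K"
  by (auto simp: real_valuation_def msum_singleton)

lemma real_valuation_lincomb:
  assumes "real_valuation f" "real_valuation g"
  shows "real_valuation (\<lambda>K. a * f K + b * g K + c)"
  unfolding real_valuation_def
proof (intro conjI allI impI)
  fix K L :: "'a set" assume "convex_body K \<and> convex_body L \<and> convex (K \<union> L)"
  then have f: "f K + f L = f (K \<union> L) + f (K \<inter> L)" and g: "g K + g L = g (K \<union> L) + g (K \<inter> L)"
    using real_valuationD[of _ K L] assms by auto
  have "a * (f K + f L) + b * (g K + g L) = a * (f (K \<union> L) + f (K \<inter> L)) + b * (g (K \<union> L) + g (K \<inter> L))"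
    unfolding f g ..
  then show "(a * f K + b * g K + c) + (a * f L + b * g L + c)
      = (a * f (K \<union> L) + b * g (K \<union> L) + c) + (a * f (K \<inter> L) + b * g (K \<inter> L) + c)"
    by (simp add: algebra_simps)
qed (use assms in \<open>auto simp: real_valuation_def\<close>)

text \<open>This lets every dissection carry a fixed Minkowski summand: adding K respects unions
  and, by \<open>msum_Int\<close>, intersections of bodies with convex union.\<close>

lemma real_valuation_msum:
  assumes f: "real_valuation f" and K: "convex_body K"
  shows "real_valuation (\<lambda>M. f (K \<oplus> M))"
  unfolding real_valuation_def
proof (intro conjI allI impI)
  fix A B :: "'a set" assume *: "convex_body A \<and> convex_body B \<and> convex (A \<union> B)"
  then have c: "convex ((K \<oplus> A) \<union> (K \<oplus> B))"
    using convex_body_msum[OF K convex_body_Un[of A B]] by (auto simp: msum_Un convex_body_def)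
  show "f (K \<oplus> A) + f (K \<oplus> B) = f (K \<oplus> (A \<union> B)) + f (K \<oplus> (A \<inter> B))"
    using real_valuationD[OF f _ _ c] * K msum_Int[of K A B]
    by (simp add: msum_Un convex_body_msum) (simp add: convex_body_def)
next
  fix A :: "'a set" and t assume A: "convex_body A"
  have "K \<oplus> ((\<lambda>x. x + t) ` A) = (K \<oplus> A) \<oplus> {t}"
    by (simp add: msum_singleton[symmetric] msum_assoc)
  then show "f (K \<oplus> ((\<lambda>x. x + t) ` A)) = f (K \<oplus> A)"
    using real_valuation_translation[OF f] A K by auto
qed

text \<open>Cauchy's equation with a one-sided bound: a negative value c s would make c (n s) = n c
  s drop below C. Hence c is nonnegative and so monotone, and comparison with integer arguments
  leaves an error of at most c 1 / n.\<close>

lemma additive_bounded_below_linear: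
  fixes c :: "real \<Rightarrow> real"
  assumes add: "\<And>s t. 0 \<le> s \<Longrightarrow> 0 \<le> t \<Longrightarrow> c (s + t) = c s + c t"
    and bdd: "\<And>s. 0 \<le> s \<Longrightarrow> C \<le> c s"
    and s: "0 \<le> s"
  shows "c s = s * c 1" "0 \<le> c s"
proof -
  have mult: "c (real n * s) = real n * c s" if "0 \<le> s" for n s
  proof (induction n)
    case 0 then show ?case using add[of 0 0] by simp
  next
    case (Suc n) then show ?case using add[of "real n * s" s] that by (simp add: algebra_simps)
  qed
  have nonneg: "0 \<le> c s" if "0 \<le> s" for s
  proof (rule ccontr)
    assume "\<not> 0 \<le> c s"
    then obtain n :: nat where "- C < real n * (- c s)"
      using reals_Archimedean3[of "- c s"] by (meson neg_0_less_iff_less not_le)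
    then show False using bdd[of "real n * s"] mult[OF that, of n] that by simp
  qed
  then show "0 \<le> c s" using s .
  have mono: "c s \<le> c t" if "0 \<le> s" "s \<le> t" for s t
    using add[of s "t - s"] nonneg[of "t - s"] that by simp
  have "\<bar>c s - s * c 1\<bar> \<le> e" if e: "0 < e" for e
  proof -
    obtain n :: nat where n: "real n * e > c 1" "n > 0"
    proof -
      obtain n :: nat where "c 1 < real n * e" using reals_Archimedean3[OF e] by blast
      moreover from this have "n > 0" using nonneg[of 1] by (cases n) auto
      ultimately show thesis using that by blast
    qed
    define k where "k = nat \<lfloor>real n * s\<rfloor>"
    have k: "real k \<le> real n * s" "real n * s \<le> real k + 1"
      unfolding k_def using s by (auto simp: of_nat_nat)
    have "real k * c 1 \<le> real n * c s"
      using mono[OF _ k(1)] mult[of 1 k] mult[OF s, of n] by simp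
    moreover have "real n * c s \<le> (real k + 1) * c 1"
      using mono[OF _ k(2)] mult[of 1 "Suc k"] mult[OF s, of n] s by (simp add: add.commute)
    moreover have "real k * c 1 \<le> real n * s * c 1" "real n * s * c 1 \<le> (real k + 1) * c 1"
      using k nonneg[of 1] by (auto intro!: mult_right_mono)
    ultimately have "\<bar>real n * c s - real n * s * c 1\<bar> \<le> c 1" by (simp add: algebra_simps abs_le_iff)
    then have "\<bar>real n * (c s - s * c 1)\<bar> \<le> c 1"
      by (simp only: right_diff_distrib mult.assoc)
    then have "real n * \<bar>c s - s * c 1\<bar> \<le> c 1"
      by (simp add: abs_mult)
    then have "real n * \<bar>c s - s * c 1\<bar> \<le> real n * e" using n by linarith
    then show ?thesis using n(2) by simp
  qed
  then have "\<bar>c s - s * c 1\<bar> \<le> 0" by (rule dense_ge)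
  then show "c s = s * c 1" by simp
qed

lemma segment_split:
  fixes a :: "'a::euclidean_space"
  assumes "0 \<le> s" "0 \<le> t"
  shows "closed_segment 0 (s *\<^sub>R a) \<union> (closed_segment 0 (t *\<^sub>R a) \<oplus> {s *\<^sub>R a}) = closed_segment 0 ((s + t) *\<^sub>R a)"
    and "closed_segment 0 (s *\<^sub>R a) \<inter> (closed_segment 0 (t *\<^sub>R a) \<oplus> {s *\<^sub>R a}) = {s *\<^sub>R a}"
proof -
  have e: "closed_segment 0 (r *\<^sub>R a) = (\<lambda>p. p *\<^sub>R a) ` {0..r}" if "0 \<le> r" for r
    using that closed_segment_linear_image[of "\<lambda>p. p *\<^sub>R a" 0 r]
    by (simp add: linear_scaleR_left closed_segment_eq_real_ivl)
  have e2: "closed_segment 0 (t *\<^sub>R a) \<oplus> {s *\<^sub>R a} = (\<lambda>p. p *\<^sub>R a) ` {s..s+t}"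
  proof -
    have "(\<lambda>x. x + s *\<^sub>R a) ` (\<lambda>p. p *\<^sub>R a) ` {0..t} = (\<lambda>p. p *\<^sub>R a) ` (\<lambda>p. p + s) ` {0..t}"
      by (simp only: image_image scaleR_left_distrib)
    moreover have "(\<lambda>p. p + s) ` {0..t} = {s..s+t}"
      by (simp add: add.commute)
    ultimately show ?thesis using assms(2) by (simp only: e msum_singleton)
  qed
  have "{0..s} \<union> {s..s+t} = {0..s+t}" using assms by auto
  then show "closed_segment 0 (s *\<^sub>R a) \<union> (closed_segment 0 (t *\<^sub>R a) \<oplus> {s *\<^sub>R a}) = closed_segment 0 ((s + t) *\<^sub>R a)"
    using assms unfolding e2 by (simp only: e image_Un[symmetric] add_nonneg_nonneg)
  show "closed_segment 0 (s *\<^sub>R a) \<inter> (closed_segment 0 (t *\<^sub>R a) \<oplus> {s *\<^sub>R a}) = {s *\<^sub>R a}"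
  proof (cases "a = 0")
    case False
    then have "inj (\<lambda>p. p *\<^sub>R a)" by (auto simp: inj_on_def)
    moreover have "{0..s} \<inter> {s..s+t} = {s}" using assms by auto
    ultimately show ?thesis using assms unfolding e2 by (simp add: e image_Int[symmetric])
  qed simp
qed

text \<open>The segment [0, (s + t) a] is [0, s a] followed by a translate of [0, t a], with one
  common point. So the increment over f K is additive in s, and the lower bound on f makes it linear
  and nonnegative.\<close>

lemma valuation_add_segment:
  assumes f: "real_valuation f" and bdd: "\<And>K. convex_body K \<Longrightarrow> C \<le> f K"
    and K: "convex_body K"
  shows "0 \<le> s \<Longrightarrow> f (K \<oplus> closed_segment 0 (s *\<^sub>R a)) = f K + s * (f (K \<oplus> closed_segment 0 a) - f K)"
    and "f K \<le> f (K \<oplus> closed_segment 0 a)"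
proof -
  define c where "c s = f (K \<oplus> closed_segment 0 (s *\<^sub>R a)) - f K" for s
  have g: "real_valuation (\<lambda>M. f (K \<oplus> M))" using f K by (rule real_valuation_msum)
  have add: "c (s + t) = c s + c t" if st: "0 \<le> s" "0 \<le> t" for s t
  proof -
    have "f (K \<oplus> closed_segment 0 (s *\<^sub>R a)) + f (K \<oplus> (closed_segment 0 (t *\<^sub>R a) \<oplus> {s *\<^sub>R a}))
        = f (K \<oplus> closed_segment 0 ((s + t) *\<^sub>R a)) + f (K \<oplus> {s *\<^sub>R a})"
      using real_valuationD[OF g, of "closed_segment 0 (s *\<^sub>R a)" "closed_segment 0 (t *\<^sub>R a) \<oplus> {s *\<^sub>R a}"]
      by (simp add: segment_split[OF st] convex_body_msum)
    then show ?thesis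
      using real_valuation_translation[OF g, of "closed_segment 0 (t *\<^sub>R a)"]
        real_valuation_translation[OF f K] by (simp add: c_def)
  qed
  have bdd': "C - f K \<le> c s" for s
    using bdd[of "K \<oplus> closed_segment 0 (s *\<^sub>R a)"] K by (auto simp: c_def)
  show "0 \<le> s \<Longrightarrow> f (K \<oplus> closed_segment 0 (s *\<^sub>R a)) = f K + s * (f (K \<oplus> closed_segment 0 a) - f K)"
    using additive_bounded_below_linear(1)[of c "C - f K" s, OF add bdd'] by (simp add: c_def)
  show "f K \<le> f (K \<oplus> closed_segment 0 a)"
    using additive_bounded_below_linear(2)[of c "C - f K" 1, OF add bdd'] by (simp add: c_def)
qed

section \<open>Cutting polytopes along a common face\<close>

lemma separated_from_body:
  fixes C :: "'a::euclidean_space set"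
  assumes "convex_body C" "convex_body S" "S \<inter> C = {}"
  obtains w b where "\<And>c. c \<in> C \<Longrightarrow> w \<bullet> c < b" "\<And>y. y \<in> S \<Longrightarrow> b < w \<bullet> y"
proof -
  have "\<exists>w b. (\<forall>c\<in>C. w \<bullet> c < b) \<and> (\<forall>y\<in>S. b < w \<bullet> y)"
    using assms by (intro separating_hyperplane_closed_compact) (auto simp: convex_body_def compact_imp_closed)
  then show thesis using that by blast
qed

text \<open>If every segment from \<open>A\<close> to \<open>B\<close> meets \<open>C\<close>, then a hyperplane separating a point
  from \<open>C\<close> cannot have points of both \<open>A\<close> and \<open>B\<close> on the far side.\<close>

lemma hull_cut:
  fixes A B C :: "'a::euclidean_space set"
  assumes C: "convex_body C" and A: "finite A" and B: "finite B"
    and meet: "\<And>a b. a \<in> A \<Longrightarrow> b \<in> B \<Longrightarrow> closed_segment a b \<inter> C \<noteq> {}"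
  shows "convex hull (A \<union> C) \<union> convex hull (B \<union> C) = convex hull (A \<union> B \<union> C)"
    and "convex hull (A \<union> C) \<inter> convex hull (B \<union> C) = C"
proof -
  have far: "\<exists>a\<in>A. b < w \<bullet> a" if "y \<in> convex hull (A \<union> C)" "b < w \<bullet> y" "\<And>c. c \<in> C \<Longrightarrow> w \<bullet> c < b"
    for A :: "'a set" and b w y
  proof (rule ccontr)
    assume "\<not> ?thesis"
    then have "A \<union> C \<subseteq> {z. w \<bullet> z \<le> b}" using that(3) by force
    then have "convex hull (A \<union> C) \<subseteq> {z. w \<bullet> z \<le> b}"
      by (intro hull_minimal convex_halfspace_le)
    then show False using that(1,2) by auto
  qed
  have meet': "closed_segment y z \<inter> C \<noteq> {}"
    if y: "y \<in> convex hull (A \<union> C)" and z: "z \<in> convex hull (B \<union> C)" for y z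
  proof
    assume "closed_segment y z \<inter> C = {}"
    then obtain w b where w: "\<And>c. c \<in> C \<Longrightarrow> w \<bullet> c < b" "\<And>p. p \<in> closed_segment y z \<Longrightarrow> b < w \<bullet> p"
      using separated_from_body[OF C, of "closed_segment y z"] by auto
    obtain a where a: "a \<in> A" "b < w \<bullet> a" using far[OF y w(2) w(1)] by auto
    obtain a' where a': "a' \<in> B" "b < w \<bullet> a'" using far[OF z w(2) w(1)] by auto
    have "closed_segment a a' \<subseteq> {p. b < w \<bullet> p}"
      using a a' by (intro closed_segment_subset convex_halfspace_gt) auto
    then show False using meet[OF a(1) a'(1)] w(1) by force
  qed
  show "convex hull (A \<union> C) \<union> convex hull (B \<union> C) = convex hull (A \<union> B \<union> C)" (is "?A \<union> ?B = _")
  proof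
    show "?A \<union> ?B \<subseteq> convex hull (A \<union> B \<union> C)"
      by (intro Un_least hull_mono) auto
    have "closed_segment y z \<subseteq> ?A \<union> ?B" if yz: "y \<in> ?A \<union> ?B" "z \<in> ?A \<union> ?B" for y z
    proof -
      have *: "closed_segment y z \<subseteq> ?A \<union> ?B" if yz: "y \<in> ?A" "z \<in> ?B" for y z
      proof -
        obtain r where r: "r \<in> closed_segment y z" "r \<in> C" using meet'[OF yz] by auto
        have "r \<in> ?A" "r \<in> ?B" using r(2) by (auto intro: hull_inc)
        then have "closed_segment y r \<subseteq> ?A" "closed_segment r z \<subseteq> ?B"
          using yz closed_segment_subset[OF _ _ convex_convex_hull] by blast+
        then show ?thesis using Un_closed_segment[OF r(1)] by auto
      qed
      from yz consider "y \<in> ?A" "z \<in> ?A" | "y \<in> ?B" "z \<in> ?B" | "y \<in> ?A" "z \<in> ?B" | "z \<in> ?A" "y \<in> ?B"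
        by auto
      then show ?thesis
      proof cases
        case 1 then show ?thesis using closed_segment_subset[OF _ _ convex_convex_hull] by blast
      next
        case 2 then show ?thesis using closed_segment_subset[OF _ _ convex_convex_hull] by blast
      next
        case 3 then show ?thesis by (rule *)
      next
        case 4 then show ?thesis using *[of z y] by (simp add: closed_segment_commute)
      qed
    qed
    then have "convex (?A \<union> ?B)" by (simp add: convex_contains_segment)
    then show "convex hull (A \<union> B \<union> C) \<subseteq> ?A \<union> ?B"
      by (intro hull_minimal) (auto intro: hull_inc)
  qed
  show "?A \<inter> ?B = C"
  proof
    show "C \<subseteq> ?A \<inter> ?B" by (auto intro: hull_inc)
    show "?A \<inter> ?B \<subseteq> C"
    proof
      fix y assume "y \<in> ?A \<inter> ?B"
      then show "y \<in> C" using meet'[of y y] by auto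
    qed
  qed
qed

lemma convex_hull_Un_hull: "convex hull (A \<union> convex hull C) = convex hull (A \<union> C)"
proof
  have "convex hull C \<subseteq> convex hull (A \<union> C)" by (intro hull_mono) auto
  then show "convex hull (A \<union> convex hull C) \<subseteq> convex hull (A \<union> C)"
    by (intro hull_minimal) (auto intro: hull_inc)
  show "convex hull (A \<union> C) \<subseteq> convex hull (A \<union> convex hull C)"
    by (intro hull_mono) (auto intro: hull_inc)
qed

text \<open>C spans the common face; A and B hold the remaining vertices on its two sides. The
  condition concerns vertices only, so it can be checked without coordinates and also for degenerate
  polytopes.\<close>

lemma valuation_cut:
  fixes A B C :: "'a::euclidean_space set"
  assumes f: "real_valuation f" and K: "convex_body K"
    and fin: "finite A" "finite B" "finite C" "C \<noteq> {}"
    and meet: "\<And>a b. a \<in> A \<Longrightarrow> b \<in> B \<Longrightarrow> \<exists>c\<in>closed_segment a b. c \<in> convex hull C"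
  shows "f (K \<oplus> convex hull (A \<union> C)) + f (K \<oplus> convex hull (B \<union> C))
       = f (K \<oplus> convex hull (A \<union> B \<union> C)) + f (K \<oplus> convex hull C)"
proof -
  have "convex_body (convex hull C)" using fin by (intro convex_body_hull)
  from hull_cut[OF this fin(1,2)] have "(\<And>a b. a \<in> A \<Longrightarrow> b \<in> B \<Longrightarrow> closed_segment a b \<inter> convex hull C \<noteq> {}) \<Longrightarrow> ?thesis"
    using real_valuationD[OF real_valuation_msum[OF f K], of "convex hull (A \<union> C)" "convex hull (B \<union> C)"] fin
    by (simp add: convex_hull_Un_hull convex_body_hull)
  then show ?thesis using meet by fast
qed

section \<open>Dissections into path simplices\<close>

primrec partial_sums :: "'a::euclidean_space list \<Rightarrow> 'a set" where
  "partial_sums [] = {0}"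
| "partial_sums (b # bs) = insert 0 ((+) b ` partial_sums bs)"

text \<open>With \<open>b = [b\<^sub>1, \<dots>, b\<^sub>k]\<close> this is
  \<open>T(b) = {x\<^sub>1 b\<^sub>1 + \<dots> + x\<^sub>k b\<^sub>k | 1 \<ge> x\<^sub>1 \<ge> \<dots> \<ge> x\<^sub>k \<ge> 0}\<close>; the \<open>b\<^sub>i\<close> may be dependent.\<close>

definition path_simplex :: "'a::euclidean_space list \<Rightarrow> 'a set" where
  "path_simplex bs = convex hull (partial_sums bs)"

text \<open>Sums are considered because cutting 2 T(b) yields sums of two shorter simplices. Blocks
  of length one are segments, so zonotopes are a special case.\<close>

primrec simplex_sum :: "'a::euclidean_space list list \<Rightarrow> 'a set" where
  "simplex_sum [] = {0}"
| "simplex_sum (b # bs) = path_simplex b \<oplus> simplex_sum bs"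

lemma finite_partial_sums [simp]: "finite (partial_sums bs)"
  by (induction bs) auto

lemma zero_in_partial_sums [simp]: "0 \<in> partial_sums bs"
  by (cases bs) auto

lemma partial_sums_nonempty [simp]: "partial_sums bs \<noteq> {}"
  using zero_in_partial_sums by blast

lemma partial_sums_append:
  "partial_sums (p @ q) = partial_sums p \<union> (+) (sum_list p) ` partial_sums q"
  by (induction p) (auto simp: image_Un image_image add.assoc)

lemma sum_list_in_partial_sums [simp]: "sum_list bs \<in> partial_sums bs"
  by (induction bs) auto

lemma partial_sums_scaleR: "partial_sums (map ((*\<^sub>R) r) bs) = (*\<^sub>R) r ` partial_sums bs"
  by (induction bs) (auto simp: image_image scaleR_right_distrib)

lemma convex_body_path_simplex [simp]: "convex_body (path_simplex bs)"
  by (simp add: path_simplex_def convex_body_hull)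

lemma convex_body_simplex_sum [simp]: "convex_body (simplex_sum bss)"
  by (induction bss) auto

lemma path_simplex_Nil [simp]: "path_simplex [] = {0}"
  by (simp add: path_simplex_def)

lemma path_simplex_single [simp]: "path_simplex [a] = closed_segment 0 a"
  by (simp add: path_simplex_def segment_convex_hull)

lemma convex_double:
  assumes "convex S"
  shows "S \<oplus> S = (*\<^sub>R) 2 ` S"
proof (intro equalityI subsetI)
  fix z assume "z \<in> S \<oplus> S"
  then obtain x y where xy: "x \<in> S" "y \<in> S" "z = x + y" by (auto simp: msum_def)
  then have "(1/2) *\<^sub>R x + (1/2) *\<^sub>R y \<in> S" using assms by (intro convexD) auto
  moreover have "z = 2 *\<^sub>R ((1/2) *\<^sub>R x + (1/2) *\<^sub>R y)" using xy by (simp add: scaleR_right_distrib)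
  ultimately show "z \<in> (*\<^sub>R) 2 ` S" by blast
qed (auto simp: msum_def scaleR_2)

lemma path_simplex_double: "path_simplex (map ((*\<^sub>R) 2) bs) = path_simplex bs \<oplus> path_simplex bs"
  by (simp add: path_simplex_def partial_sums_scaleR convex_hull_scaling convex_double)

text \<open>Both dissections verify the condition of \<open>valuation_cut\<close> in this way: two
  vertices on opposite sides are opposite corners of a parallelogram whose other corners lie in the
  common face. Linear dependence of the edge vectors does no harm here.\<close>

lemma midpoint_meets_hull:
  assumes "x + y = s + t" "s \<in> C" "t \<in> C"
  shows "\<exists>c\<in>closed_segment x y. c \<in> convex hull C"
proof -
  have "midpoint x y = midpoint s t" using assms(1) by (simp add: midpoint_def)
  moreover have "midpoint s t \<in> convex hull C"
    using assms(2,3) closed_segment_subset[OF hull_inc hull_inc convex_convex_hull, of s C t]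
      midpoint_in_closed_segment by blast
  ultimately show ?thesis using midpoint_in_closed_segment by metis
qed

text \<open>The prism \<open>T(b) + [0, a]\<close> is cut along the hyperplanes where the coordinate of \<open>a\<close>
  equals the coordinate of one of the \<open>b\<^sub>i\<close>; the set below is the part that is left
  when \<open>p\<close> has been processed.\<close>

definition prism_rest :: "'a::euclidean_space \<Rightarrow> 'a list \<Rightarrow> 'a list \<Rightarrow> 'a set" where
  "prism_rest a p q = partial_sums (p @ q) \<union> (+) (sum_list p + a) ` partial_sums q"

text \<open>Let y be the coordinate of a. The cut is along y = x_c: the part y >= x_c is T(p, a, c,
  q), the part y <= x_c is the next rest, and the common face is T(p, c + a, q).\<close>

lemma prism_step:
  assumes f: "real_valuation f" and R: "convex_body R"
  shows "f (R \<oplus> convex hull (prism_rest a p (c # q))) + f (R \<oplus> path_simplex (p @ (c + a) # q))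
       = f (R \<oplus> path_simplex (p @ a # c # q)) + f (R \<oplus> convex hull (prism_rest a (p @ [c]) q))"
proof -
  define s where "s = sum_list p"
  define X where "X = (+) (s + c) ` partial_sums q"
  define C where "C = partial_sums p \<union> (+) (s + c + a) ` partial_sums q"
  have s: "s \<in> partial_sums p" by (simp add: s_def)
  have 1: "partial_sums (p @ a # c # q) = {s + a} \<union> C"
    using s by (auto simp: C_def partial_sums_append image_Un image_image s_def add_ac)
  have 2: "partial_sums (p @ (c + a) # q) = C"
    using s by (auto simp: C_def partial_sums_append image_Un image_image s_def add_ac)
  have 3: "prism_rest a (p @ [c]) q = X \<union> C"
    using s by (auto simp: C_def X_def prism_rest_def partial_sums_append image_Un image_image s_def add_ac)
  have 4: "prism_rest a p (c # q) = {s + a} \<union> X \<union> C"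
    using s by (auto simp: C_def X_def prism_rest_def partial_sums_append image_Un image_image s_def add_ac)
  have "\<exists>r\<in>closed_segment y z. r \<in> convex hull C" if "y \<in> {s + a}" "z \<in> X" for y z
  proof -
    from that obtain w where "w \<in> partial_sums q" "z = s + c + w" "y = s + a" by (auto simp: X_def)
    then show ?thesis
      using s by (intro midpoint_meets_hull[of y z s "s + c + a + w"]) (auto simp: C_def)
  qed
  moreover have "finite X" "finite C" "C \<noteq> {}" by (simp_all add: C_def X_def)
  ultimately have "f (R \<oplus> convex hull ({s + a} \<union> C)) + f (R \<oplus> convex hull (X \<union> C))
      = f (R \<oplus> convex hull ({s + a} \<union> X \<union> C)) + f (R \<oplus> convex hull C)"
    by (intro valuation_cut[OF f R]) simp_all
  then show ?thesis unfolding path_simplex_def 1 2 3 4 by (simp only:)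
qed

text \<open>Peeling off one simplex at a time uses common faces T(bs) with bs one shorter, where f
  is zero. So f of the rest is a sum of values on full-length simplices.\<close>

lemma prism_nonneg:
  assumes f: "real_valuation f" and R: "convex_body R"
    and zero: "\<And>bs. length bs = length p + length q \<Longrightarrow> f (R \<oplus> path_simplex bs) = 0"
    and nonneg: "\<And>bs. length bs = Suc (length p + length q) \<Longrightarrow> 0 \<le> f (R \<oplus> path_simplex bs)"
  shows "0 \<le> f (R \<oplus> convex hull (prism_rest a p q))"
  using zero nonneg
proof (induction q arbitrary: p)
  case Nil
  have "prism_rest a p [] = partial_sums (p @ [a])"
    by (auto simp: prism_rest_def partial_sums_append image_Un)
  then show ?case using Nil(2)[of "p @ [a]"] by (simp add: path_simplex_def)
next
  case (Cons c q)
  have "0 \<le> f (R \<oplus> convex hull (prism_rest a (p @ [c]) q))"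
    using Cons.prems by (intro Cons.IH) auto
  then show ?case
    using prism_step[OF f R, of a p c q] Cons.prems(1)[of "p @ (c + a) # q"]
      Cons.prems(2)[of "p @ a # c # q"] by simp
qed

text \<open>On the prism f is 0, and this is the sum of the values on T(a # b) and on the rest, both
  nonnegative. The first piece is enough, since every nonempty list has the form a # b.\<close>

lemma prism_insertion:
  assumes f: "real_valuation f" and R: "convex_body R"
    and zero: "\<And>bs. length bs = length b \<Longrightarrow> f (R \<oplus> path_simplex bs) = 0"
    and nonneg: "\<And>bs. length bs = Suc (length b) \<Longrightarrow> 0 \<le> f (R \<oplus> path_simplex bs)"
    and prism: "f (R \<oplus> (path_simplex b \<oplus> closed_segment 0 a)) = 0"
  shows "f (R \<oplus> path_simplex (a # b)) = 0"
proof (cases b)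
  case Nil
  then show ?thesis using prism by simp
next
  case (Cons c q)
  have "{0, a} = {0} \<union> {a}" by auto
  then have "partial_sums b \<oplus> {0, a} = prism_rest a [] b"
    by (simp only: msum_Un) (simp add: prism_rest_def msum_singleton add.commute)
  then have "convex hull (prism_rest a [] b) = path_simplex b \<oplus> closed_segment 0 a"
    unfolding path_simplex_def segment_convex_hull by (metis convex_hull_msum)
  then have "f (R \<oplus> path_simplex (a # b)) + f (R \<oplus> convex hull (prism_rest a [c] q)) = 0"
    using prism_step[OF f R, of a "[]" c q] prism zero[of "(c + a) # q"] Cons by simp
  moreover have "0 \<le> f (R \<oplus> convex hull (prism_rest a [c] q))"
    using zero nonneg Cons by (intro prism_nonneg[OF f R]) auto
  ultimately show ?thesis using nonneg[of "a # b"] by simp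
qed

text \<open>Similarly \<open>2 T(b)\<close> is cut along the hyperplanes where a coordinate equals 1.\<close>

definition double_rest :: "'a::euclidean_space list \<Rightarrow> 'a list \<Rightarrow> 'a set" where
  "double_rest p q = (let X = (+) (sum_list p) ` partial_sums q in (partial_sums p \<oplus> X) \<union> (X \<oplus> X))"

text \<open>The rest consists of the points of 2 T(p @ c # q) whose p-coordinates are at least 1,
  and it is cut at x_c = 1. The part x_c <= 1 is a translate of T(p) + T(c # q), the common face a
  translate of T(p) + T(q).\<close>

lemma double_step:
  assumes f: "real_valuation f" and R: "convex_body R"
  shows "f (R \<oplus> convex hull (double_rest p (c # q))) + f (R \<oplus> (path_simplex p \<oplus> path_simplex q))
       = f (R \<oplus> (path_simplex p \<oplus> path_simplex (c # q))) + f (R \<oplus> convex hull (double_rest (p @ [c]) q))"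
proof -
  define s where "s = sum_list p"
  define X where "X = (+) (s + c) ` partial_sums q"
  define C where "C = partial_sums p \<oplus> X"
  have s: "s \<in> partial_sums p" by (simp add: s_def)
  have sc: "s + c \<in> X" by (auto simp: X_def image_iff intro!: bexI[of _ 0])
  have hull_shift: "f (R \<oplus> convex hull (partial_sums p \<oplus> (+) t ` partial_sums bs))
      = f (R \<oplus> (path_simplex p \<oplus> path_simplex bs))" for t bs
  proof -
    have "(+) t ` partial_sums bs = partial_sums bs \<oplus> {t}" by (auto simp: msum_def add.commute)
    then have "R \<oplus> convex hull (partial_sums p \<oplus> (+) t ` partial_sums bs)
        = (R \<oplus> (path_simplex p \<oplus> path_simplex bs)) \<oplus> {t}"
      by (simp add: convex_hull_msum path_simplex_def msum_assoc)
    then show ?thesis using R by (simp add: real_valuation_translation[OF f])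
  qed
  \<comment> \<open>On A the coordinate x_c is 0, on C it is 1, and on the sums of two elements of X
    it is 2.\<close>
  define A where "A = partial_sums p \<oplus> {s}"
  have X0: "(+) s ` partial_sums (c # q) = insert s X"
    by (auto simp: X_def image_image add.assoc)
  have 1: "partial_sums p \<oplus> (+) s ` partial_sums (c # q) = A \<union> C"
    unfolding X0 A_def C_def by (auto simp: msum_def)
  have 2: "double_rest (p @ [c]) q = (X \<oplus> X) \<union> C"
  proof -
    have "partial_sums (p @ [c]) = insert (s + c) (partial_sums p)"
      using s by (auto simp: partial_sums_append s_def)
    then have "partial_sums (p @ [c]) = partial_sums p \<union> {s + c}" by simp
    moreover have "{s + c} \<oplus> X \<subseteq> X \<oplus> X" using sc by (intro msum_mono) auto
    moreover have "double_rest (p @ [c]) q = (X \<oplus> partial_sums (p @ [c])) \<union> (X \<oplus> X)"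
      by (simp add: double_rest_def Let_def X_def s_def msum_commute)
    ultimately show ?thesis
      by (simp only: msum_Un C_def msum_commute) blast
  qed
  have 3: "double_rest p (c # q) = A \<union> (X \<oplus> X) \<union> C"
  proof -
    have "insert s X \<oplus> insert s X \<subseteq> A \<union> (X \<oplus> X) \<union> C"
    proof
      fix z assume "z \<in> insert s X \<oplus> insert s X"
      then obtain x y where xy: "x = s \<or> x \<in> X" "y = s \<or> y \<in> X" "z = x + y" by (auto simp: msum_def)
      have "s + s \<in> A" using s by (auto simp: A_def msum_def)
      moreover have "s + y \<in> C" "y + s \<in> C" if "y \<in> X" for y
        using msumI[OF s that] by (simp_all add: C_def add.commute)
      moreover have "x + y \<in> X \<oplus> X" if "x \<in> X" "y \<in> X" using that by (auto simp: msum_def)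
      ultimately show "z \<in> A \<union> (X \<oplus> X) \<union> C" using xy by auto
    qed
    moreover have "X \<oplus> X \<subseteq> insert s X \<oplus> insert s X" by (intro msum_mono) auto
    moreover have "double_rest p (c # q) = A \<union> C \<union> (insert s X \<oplus> insert s X)"
      unfolding double_rest_def Let_def s_def[symmetric] X0 1[unfolded X0] ..
    ultimately show ?thesis by blast
  qed
  have "\<exists>r\<in>closed_segment y z. r \<in> convex hull C" if "y \<in> A" "z \<in> X \<oplus> X" for y z
  proof -
    from that obtain w x x' where w: "w \<in> partial_sums p" "y = w + s" "x \<in> X" "x' \<in> X" "z = x + x'"
      by (auto simp: A_def msum_def)
    then show ?thesis
      using s by (intro midpoint_meets_hull[of y z "w + x" "s + x'"]) (auto simp: C_def intro!: msumI)
  qed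
  moreover have "finite (M \<oplus> N)" if "finite M" "finite N" for M N :: "'a set"
    using that by (simp add: msum_conv_set_plus finite_set_plus)
  moreover have "C \<noteq> {}" using s sc by (auto simp: C_def msum_def)
  ultimately have "f (R \<oplus> convex hull (A \<union> C)) + f (R \<oplus> convex hull ((X \<oplus> X) \<union> C))
      = f (R \<oplus> convex hull (A \<union> (X \<oplus> X) \<union> C)) + f (R \<oplus> convex hull C)"
    by (intro valuation_cut[OF f R]) (auto simp: A_def C_def X_def)
  moreover have "f (R \<oplus> convex hull C) = f (R \<oplus> (path_simplex p \<oplus> path_simplex q))"
    unfolding C_def X_def hull_shift ..
  moreover have "f (R \<oplus> convex hull (A \<union> C)) = f (R \<oplus> (path_simplex p \<oplus> path_simplex (c # q)))"
    unfolding 1[symmetric] hull_shift ..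
  ultimately show ?thesis unfolding 2 3 by (simp only:)
qed

text \<open>Each cut removes a sum T(p') + T(q') on which f is zero, along a face on which f is
  zero. What finally remains, with all coordinates at least 1, is a translate of T(p @ q).\<close>

lemma double_rest_zero:
  assumes f: "real_valuation f" and R: "convex_body R" and p: "p \<noteq> []"
    and split: "\<And>p' q'. p' \<noteq> [] \<Longrightarrow> q' \<noteq> [] \<Longrightarrow> p' @ q' = p @ q \<Longrightarrow> f (R \<oplus> (path_simplex p' \<oplus> path_simplex q')) = 0"
    and skip: "\<And>p' c q'. p' @ c # q' = p @ q \<Longrightarrow> f (R \<oplus> (path_simplex p' \<oplus> path_simplex q')) = 0"
  shows "f (R \<oplus> convex hull (double_rest p q)) = f (R \<oplus> path_simplex (p @ q))"
  using p split skip
proof (induction q arbitrary: p)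
  case Nil
  have "double_rest p [] = partial_sums p \<oplus> {sum_list p}"
    by (auto simp: double_rest_def Let_def msum_def)
  then have "R \<oplus> convex hull (double_rest p []) = (R \<oplus> path_simplex p) \<oplus> {sum_list p}"
    by (simp add: convex_hull_msum path_simplex_def msum_assoc)
  then show ?case using R by (simp add: real_valuation_translation[OF f])
next
  case (Cons c q)
  have "f (R \<oplus> convex hull (double_rest (p @ [c]) q)) = f (R \<oplus> path_simplex ((p @ [c]) @ q))"
    using Cons.prems by (intro Cons.IH) auto
  then show ?case
    using double_step[OF f R, of p c q] Cons.prems(1) Cons.prems(2)[of p "c # q"] Cons.prems(3)[of p c q]
    by simp
qed

text \<open>Of the pieces of 2 T(b), the first (all coordinates at most 1) and the last (all at
  least 1) are translates of T(b), whence the factor 2. The others are sums of two shorter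
  simplices.\<close>

lemma path_simplex_doubling:
  assumes f: "real_valuation f" and R: "convex_body R" and b: "b \<noteq> []"
    and split: "\<And>p q. p \<noteq> [] \<Longrightarrow> q \<noteq> [] \<Longrightarrow> p @ q = b \<Longrightarrow> f (R \<oplus> (path_simplex p \<oplus> path_simplex q)) = 0"
    and skip: "\<And>p c q. p @ c # q = b \<Longrightarrow> f (R \<oplus> (path_simplex p \<oplus> path_simplex q)) = 0"
  shows "f (R \<oplus> path_simplex (map ((*\<^sub>R) 2) b)) = 2 * f (R \<oplus> path_simplex b)"
proof -
  obtain c q where b': "b = c # q" using b by (cases b) auto
  have "partial_sums b \<subseteq> partial_sums b \<oplus> partial_sums b"
    using msumI[of _ "partial_sums b" 0 "partial_sums b"] by auto
  then have "double_rest [] b = partial_sums b \<oplus> partial_sums b"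
    by (auto simp: double_rest_def Let_def)
  then have "convex hull (double_rest [] b) = path_simplex (map ((*\<^sub>R) 2) b)"
    by (simp only: path_simplex_double convex_hull_msum path_simplex_def[of b])
  moreover have "f (R \<oplus> convex hull (double_rest [c] q)) = f (R \<oplus> path_simplex ([c] @ q))"
    using split skip b' by (intro double_rest_zero[OF f R]) auto
  ultimately show ?thesis
    using double_step[OF f R, of "[]" c q] skip[of "[]" c q] b' by simp
qed

lemma simplex_sum_append: "simplex_sum (xs @ ys) = simplex_sum xs \<oplus> simplex_sum ys"
  by (induction xs) (auto simp: msum_assoc)

lemma simplex_sum_singletons:
  assumes "\<forall>b\<in>set bss. length b \<le> 1"
  shows "simplex_sum bss = simplex_sum (map (\<lambda>a. [a]) (concat bss))"
  using assms
proof (induction bss)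
  case (Cons b bss)
  then have "b = [] \<or> (\<exists>a. b = [a])" by (cases b) auto
  then show ?case using Cons by auto
qed simp

text \<open>The doubling identity makes \<open>f\<close> homogeneous of degree 1 in each block, from which \<open>sgn\<close> has to
  yield the sign; by the prism dissection, nonnegative values then sum to zero.\<close>

theorem valuation_simplex_sum_eq_0:
  fixes f :: "'a::euclidean_space set \<Rightarrow> real"
  assumes f: "real_valuation f"
    and zonotope: "\<And>as. length as \<le> n \<Longrightarrow> f (simplex_sum (map (\<lambda>a. [a]) as)) = 0"
    and sgn: "\<And>b bss. 2 \<le> length b \<Longrightarrow> length b + length (concat bss) \<le> n \<Longrightarrow>
      (\<And>r. 0 < r \<Longrightarrow> f (simplex_sum (map ((*\<^sub>R) (2 * r)) b # bss)) = 2 * f (simplex_sum (map ((*\<^sub>R) r) b # bss)))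
      \<Longrightarrow> 0 \<le> f (simplex_sum (b # bss))"
    and "length (concat bss) \<le> n"
  shows "f (simplex_sum bss) = 0"
  using assms(4)
\<comment> \<open>The measure is zero exactly when no block is longer than one. Splitting a block
  into two nonempty ones of the same total length lowers it by one.\<close>
proof (induction "sum_list (map (\<lambda>b. length b - 1) bss)" arbitrary: bss rule: less_induct)
  case less
  show ?case
  proof (cases "\<forall>b\<in>set bss. length b \<le> 1")
    case True
    then show ?thesis using simplex_sum_singletons[OF True] zonotope[OF less.prems] by simp
  next
    case False
    then obtain b xs ys where b: "bss = xs @ b # ys" "2 \<le> length b"
      by (metis One_nat_def Suc_leI not_le numeral_2_eq_2 split_list)
    define zs where "zs = xs @ ys"
    define R where "R = simplex_sum zs"
    have R: "convex_body R" by (simp add: R_def)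
    have len: "length b + length (concat zs) \<le> n" using less.prems b(1) by (simp add: zs_def)
    define d where "d = sum_list (map (\<lambda>b. length b - 1) zs)"
    have d: "sum_list (map (\<lambda>b. length b - 1) bss) = (length b - 1) + d"
      by (simp add: b(1) d_def zs_def)
    have IH: "f (R \<oplus> simplex_sum ps) = 0"
      if "sum_list (map (\<lambda>b. length b - 1) ps) < length b - 1" "length (concat ps) \<le> length b" for ps
      using less.hyps[of "zs @ ps"] that len d by (simp add: simplex_sum_append R_def d_def)
    have short: "f (R \<oplus> path_simplex p) = 0" if "length p < length b" for p
      using IH[of "[p]"] that b(2) by (cases p) auto
    have pair: "f (R \<oplus> (path_simplex p \<oplus> path_simplex q)) = 0"
      if "length p - 1 + (length q - 1) < length b - 1" "length p + length q \<le> length b" for p q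
      using IH[of "[p, q]"] that by auto
    have sum_front: "simplex_sum (c # zs) = R \<oplus> path_simplex c" for c
      by (simp add: R_def msum_commute)
    \<comment> \<open>All c of this length are needed, because the prism dissection produces
      simplices with edge vectors other than those of b.\<close>
    have nonneg: "0 \<le> f (R \<oplus> path_simplex c)" if c: "length c = length b" for c
    proof -
      have "f (simplex_sum (map ((*\<^sub>R) (2 * r)) c # zs)) = 2 * f (simplex_sum (map ((*\<^sub>R) r) c # zs))" for r
      proof -
        have "map ((*\<^sub>R) (2 * r)) c = map ((*\<^sub>R) 2) (map ((*\<^sub>R) r) c)" by simp
        moreover have "f (R \<oplus> path_simplex (map ((*\<^sub>R) 2) (map ((*\<^sub>R) r) c))) = 2 * f (R \<oplus> path_simplex (map ((*\<^sub>R) r) c))"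
        proof (rule path_simplex_doubling[OF f R])
          show "map ((*\<^sub>R) r) c \<noteq> []" using b(2) c by auto
        next
          fix p q assume h: "p \<noteq> []" "q \<noteq> []" "p @ q = map ((*\<^sub>R) r) c"
          have "length p + length q = length b" using arg_cong[OF h(3), of length] c by simp
          moreover have "0 < length p" "0 < length q" using h by auto
          ultimately show "f (R \<oplus> (path_simplex p \<oplus> path_simplex q)) = 0" by (intro pair) linarith+
        next
          fix p x q assume h: "p @ x # q = map ((*\<^sub>R) r) c"
          have "length p + length q + 1 = length b" using arg_cong[OF h, of length] c by simp
          then show "f (R \<oplus> (path_simplex p \<oplus> path_simplex q)) = 0" using b(2) by (intro pair) auto
        qed
        ultimately show ?thesis by (simp only: sum_front)
      qed
      then have "0 \<le> f (simplex_sum (c # zs))" using b(2) c len by (intro sgn) simp_all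
      then show ?thesis by (simp only: sum_front)
    qed
    obtain a c where ac: "b = a # c" using b(2) by (cases b) auto
    have "f (R \<oplus> path_simplex (a # c)) = 0"
    proof (rule prism_insertion[OF f R])
      \<comment> \<open>The prism has blocks of lengths \<open>length b - 1\<close> and 1 in place
        of b, so the induction hypothesis applies to it.\<close>
      show "f (R \<oplus> (path_simplex c \<oplus> closed_segment 0 a)) = 0"
        using pair[of c "[a]"] ac b(2) by simp
    qed (use short nonneg ac in auto)
    then show ?thesis
      using sum_front[of b] by (simp add: b(1) ac zs_def simplex_sum_append msum_left_commute)
  qed
qed

section \<open>From simplices to polytopes by Radon's theorem\<close>

lemma hull_insert_pair_split:
  fixes a1 a2 :: "'a::euclidean_space"
  assumes "r \<in> convex hull (insert a1 (insert a2 A))"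
  shows "\<exists>s\<in>closed_segment a1 a2. r \<in> convex hull (insert s A)"
proof (cases "A = {}")
  case True
  then show ?thesis using assms by (intro bexI[of _ r]) (auto simp: segment_convex_hull)
next
  case False
  from assms obtain u v y where 1: "0 \<le> u" "0 \<le> v" "u + v = 1" "y \<in> convex hull (insert a2 A)"
    "r = u *\<^sub>R a1 + v *\<^sub>R y"
    by (auto simp: convex_hull_insert)
  then obtain u' v' z where 2: "0 \<le> u'" "0 \<le> v'" "u' + v' = 1" "z \<in> convex hull A"
    "y = u' *\<^sub>R a2 + v' *\<^sub>R z"
    using False by (auto simp: convex_hull_insert)
  \<comment> \<open>The point r is a convex combination of a1, a2 and z; t is the joint weight of a1
    and a2, and s is their normalised combination. If t = 0, then r lies in the hull of A and any s
    will do.\<close>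
  define t where "t = u + v * u'"
  show ?thesis
  proof (cases "t = 0")
    case True
    moreover have "0 \<le> v * u'" using 1 2 by simp
    ultimately have "u = 0" "v * u' = 0" using 1(1) unfolding t_def by linarith+
    then have "r = z" using 1 2 by auto
    then have "r \<in> convex hull (insert a1 A)" using 2(4) hull_mono[of A "insert a1 A"] by auto
    then show ?thesis by (intro bexI[of _ a1]) auto
  next
    case False
    then have t: "0 < t" using 1 2 by (simp add: t_def order_less_le)
    define s where "s = (u / t) *\<^sub>R a1 + (v * u' / t) *\<^sub>R a2"
    have "u / t + v * u' / t = 1" using t by (simp add: t_def add_divide_distrib[symmetric])
    then have s: "s \<in> closed_segment a1 a2"
      unfolding s_def using 1 2 t
      by (intro convexD[OF convex_closed_segment]) auto
    have "t + v * v' = 1" using 1(3) 2(3) unfolding t_def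
      by (metis add.assoc distrib_left mult.right_neutral)
    moreover have "r = t *\<^sub>R s + (v * v') *\<^sub>R z"
      using t by (simp add: 1(5) 2(5) s_def scaleR_right_distrib)
    moreover have "z \<in> convex hull (insert s A)" "s \<in> convex hull (insert s A)"
      using 2(4) hull_mono[of A "insert s A"] by (auto intro: hull_inc)
    ultimately have "r \<in> convex hull (insert s A)"
      using t 1(2) 2(2) convexD[OF convex_convex_hull, of s "insert s A" z t "v * v'"] by simp
    then show ?thesis using s by blast
  qed
qed

text \<open>A Radon point \<open>r\<close> of \<open>A\<close> and \<open>B\<close> lies in \<open>conv (A' \<union> {s})\<close> for a point \<open>s\<close> of an edge
  \<open>[a\<^sub>1, a\<^sub>2]\<close> and \<open>A' = A - {a\<^sub>1, a\<^sub>2}\<close>. Splitting the edge at \<open>s\<close> and moving \<open>a\<^sub>1\<close> or \<open>a\<^sub>2\<close>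
  to \<open>B\<close> shrinks \<open>A\<close>.\<close>

lemma valuation_radon:
  fixes A B :: "'a::euclidean_space set"
  assumes f: "real_valuation f"
    and small: "\<And>V. finite V \<Longrightarrow> V \<noteq> {} \<Longrightarrow> card V < m \<Longrightarrow> f (convex hull V) = 0"
    and "finite A" "finite B" "card A + card B \<le> m" "convex hull A \<inter> convex hull B \<noteq> {}"
  shows "f (convex hull (A \<union> B)) = 0"
  using assms(3-)
proof (induction "card A" arbitrary: A B rule: less_induct)
  case less
  obtain r where r: "r \<in> convex hull A" "r \<in> convex hull B" using less.prems by auto
  then obtain a1 where a1: "a1 \<in> A" by (cases "A = {}") auto
  show ?case
  proof (cases "A = {a1}")
    case True
    then have "convex hull (A \<union> B) = convex hull B"
      using r hull_redundant[of r convex B] by simp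
    then show ?thesis using small[of B] less.prems r True by (cases "B = {}") auto
  next
    case False
    then obtain a2 where a2: "a2 \<in> A" "a2 \<noteq> a1" using a1 by auto
    define A' where "A' = A - {a1, a2}"
    have A: "A = insert a1 (insert a2 A')" using a1 a2 by (auto simp: A'_def)
    have "finite A'" "a1 \<notin> A'" "a2 \<notin> A'" using less.prems(1) by (auto simp: A'_def)
    then have A': "finite A'" "card A = card A' + 2" using a2(2) by (simp_all add: A)
    obtain s where s: "s \<in> closed_segment a1 a2" "r \<in> convex hull (insert s A')"
      using hull_insert_pair_split r(1) A by metis
    define C where "C = insert s (A' \<union> B)"
    have C: "finite C" "C \<noteq> {}" using A' less.prems by (auto simp: C_def)
    have cC: "card C \<le> card A' + card B + 1"
      unfolding C_def using card_insert_le_m1 card_Un_le[of A' B] A' less.prems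
      by (simp add: card_insert_if)
    \<comment> \<open>Here a is the vertex moved to B. The set \<open>insert s A'\<close> is smaller
      than A and \<open>insert a B\<close> has at most one point more than B, so the bound m
      survives, and r still lies in both hulls.\<close>
    have piece: "f (convex hull ({a} \<union> C)) = 0" for a
    proof -
      have "f (convex hull (insert s A' \<union> insert a B)) = 0"
      proof (rule less.hyps)
        show "card (insert s A') < card A" using A' by (simp add: card_insert_if)
        show "card (insert s A') + card (insert a B) \<le> m"
          using A' less.prems by (simp add: card_insert_if)
        have "r \<in> convex hull (insert a B)" using r(2) hull_mono[of B "insert a B"] by auto
        then show "convex hull insert s A' \<inter> convex hull insert a B \<noteq> {}" using s by auto
      qed (use A' less.prems in auto)
      then show ?thesis by (simp add: C_def insert_commute)
    qed
    have "f ({0} \<oplus> convex hull ({a1} \<union> C)) + f ({0} \<oplus> convex hull ({a2} \<union> C))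
        = f ({0} \<oplus> convex hull ({a1} \<union> {a2} \<union> C)) + f ({0} \<oplus> convex hull C)"
      using C s(1) by (intro valuation_cut[OF f]) (auto simp: C_def intro!: bexI[of _ s] hull_inc)
    \<comment> \<open>In C the point s replaces the two vertices a1 and a2, which brings the
      cardinality below m.\<close>
    moreover have "f (convex hull C) = 0"
      using small[OF C] cC A' less.prems by simp
    moreover have "convex hull ({a1} \<union> {a2} \<union> C) = convex hull (A \<union> B)"
    proof -
      have "s \<in> convex hull (A \<union> B)"
        using s(1) hull_mono[of "{a1, a2}" "A \<union> B"] A by (auto simp: segment_convex_hull)
      then have "convex hull (insert s (A \<union> B)) = convex hull (A \<union> B)"
        by (rule hull_redundant)
      moreover have "{a1} \<union> {a2} \<union> C = insert s (A \<union> B)" by (auto simp: A C_def)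
      ultimately show ?thesis by simp
    qed
    ultimately show ?thesis using piece by simp
  qed
qed

text \<open>Induction on the number of points: up to n + 1 of them form a possibly degenerate
  simplex, while more are affinely dependent and have a Radon partition.\<close>

theorem valuation_polytope_eq_0:
  fixes f :: "'a::euclidean_space set \<Rightarrow> real"
  assumes f: "real_valuation f"
    and simplex: "\<And>bs. length bs \<le> DIM('a) \<Longrightarrow> f (path_simplex bs) = 0"
    and V: "finite V" "V \<noteq> {}"
  shows "f (convex hull V) = 0"
  using V
proof (induction "card V" arbitrary: V rule: less_induct)
  case less
  show ?case
  proof (cases "card V \<le> DIM('a) + 1")
    case True
    obtain xs where xs: "set xs = V" "distinct xs" using less.prems(1) finite_distinct_list by blast
    \<comment> \<open>A list of points is its head plus the partial sums of its consecutive
      differences.\<close>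
    have "\<exists>bs. length bs + 1 = length xs \<and> set xs = (+) (hd xs) ` partial_sums bs" if "xs \<noteq> []" for xs :: "'a list"
      using that
    proof (induction xs rule: induct_list012)
      case (2 x)
      then show ?case by (intro exI[of _ "[]"]) auto
    next
      case (3 x y xs)
      then obtain bs where bs: "length bs + 1 = length (y # xs)" "set (y # xs) = (+) y ` partial_sums bs" by auto
      have "set (x # y # xs) = (+) x ` partial_sums ((y - x) # bs)"
        using bs(2) by (auto simp: image_image)
      then show ?case using bs by (intro exI[of _ "(y - x) # bs"]) auto
    qed simp
    then obtain bs where bs: "length bs + 1 = length xs" "V = (+) (hd xs) ` partial_sums bs"
      using xs less.prems by force
    have "V = partial_sums bs \<oplus> {hd xs}" using bs by (auto simp: msum_def add.commute)
    then have "convex hull V = path_simplex bs \<oplus> {hd xs}"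
      by (simp add: convex_hull_msum path_simplex_def)
    moreover have "length bs \<le> DIM('a)" using bs True distinct_card[OF xs(2)] xs(1) by simp
    ultimately show ?thesis by (simp add: real_valuation_translation[OF f] simplex)
  next
    case False
    then have "affine_dependent V" using less.prems by (intro affine_dependent_biggerset) auto
    then obtain A B where AB: "A \<inter> B = {}" "A \<union> B = V" "convex hull A \<inter> convex hull B \<noteq> {}"
      using Radon_partition less.prems by metis
    have "f (convex hull (A \<union> B)) = 0"
    proof (rule valuation_radon[OF f])
      show "f (convex hull W) = 0" if "finite W" "W \<noteq> {}" "card W < card V" for W
        using less.hyps that by blast
      show "card A + card B \<le> card V"
        using card_Un_disjoint[of A B] AB less.prems by auto
    qed (use AB less.prems in auto)
    then show ?thesis using AB by simp
  qed
qed

section \<open>Zonotopes and volume\<close>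

abbreviation zonotope :: "'a::euclidean_space list \<Rightarrow> 'a set" where
  "zonotope as \<equiv> simplex_sum (map (\<lambda>a. [a]) as)"

lemma convex_body_lmeasurable: "convex_body K \<Longrightarrow> K \<in> lmeasurable"
  by (simp add: convex_body_def lmeasurable_compact)

lemma vol_nonneg [simp]: "0 \<le> vol K"
  by (simp add: vol_def)

lemma vol_mono: "K \<subseteq> M \<Longrightarrow> convex_body K \<Longrightarrow> convex_body M \<Longrightarrow> vol K \<le> vol M"
  unfolding vol_def by (intro measure_mono_fmeasurable) (auto simp: convex_body_lmeasurable fmeasurableD)

lemma real_valuation_vol: "real_valuation vol"
  unfolding real_valuation_def
proof (intro conjI allI impI)
  fix K L :: "'a set" assume "convex_body K \<and> convex_body L \<and> convex (K \<union> L)"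
  then show "vol K + vol L = vol (K \<union> L) + vol (K \<inter> L)"
    using measure_Un3[of K lebesgue L] by (simp add: vol_def convex_body_lmeasurable)
next
  fix K and t :: 'a
  have "(\<lambda>x. x + t) ` K = (+) t ` K" by (simp add: add.commute)
  then show "vol ((\<lambda>x. x + t) ` K) = vol K"
    unfolding vol_def by (simp only: measure_translation)
qed

lemma vol_eq_0_iff:
  fixes K :: "'a::euclidean_space set"
  assumes K: "convex_body K"
  shows "vol K = 0 \<longleftrightarrow> aff_dim K \<noteq> int DIM('a)"
proof -
  have "vol K = 0 \<longleftrightarrow> interior K = {}"
    using K convex_body_lmeasurable[OF K] negligible_iff_measure0 negligible_convex_interior
    unfolding vol_def convex_body_def by blast
  also have "\<dots> \<longleftrightarrow> aff_dim K \<noteq> int DIM('a)"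
  proof
    assume "interior K = {}"
    then have "affine hull K \<noteq> UNIV"
      using K rel_interior_interior[of K] rel_interior_eq_empty[of K] by (auto simp: convex_body_def)
    then show "aff_dim K \<noteq> int DIM('a)" by (simp add: aff_dim_eq_full)
  next
    assume "aff_dim K \<noteq> int DIM('a)"
    then show "interior K = {}" using aff_dim_nonempty_interior by blast
  qed
  finally show ?thesis .
qed

lemma simplex_sum_mset:
  assumes "mset xs = mset ys"
  shows "simplex_sum xs = simplex_sum ys"
  using assms
proof (induction xs arbitrary: ys)
  case (Cons x xs)
  then obtain us vs where ys: "ys = us @ x # vs" by (metis list.set_intros(1) mset_eq_setD split_list)
  then have "simplex_sum xs = simplex_sum (us @ vs)" using Cons by simp
  then show ?case by (simp add: ys simplex_sum_append msum_left_commute)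
qed simp

lemma zonotope_mset: "mset xs = mset ys \<Longrightarrow> zonotope xs = zonotope ys"
  by (rule simplex_sum_mset) (metis mset_map)

lemma zero_in_zonotope: "0 \<in> zonotope as"
  by (induction as) (use msumI[of 0 _ 0] in auto)

lemma set_subset_zonotope: "set as \<subseteq> zonotope as"
proof (induction as)
  case (Cons a as)
  have "a + 0 \<in> zonotope (a # as)"
    using msumI[of a "closed_segment 0 a" 0 "zonotope as"] zero_in_zonotope[of as] by simp
  moreover have "0 + b \<in> zonotope (a # as)" if "b \<in> set as" for b
    using Cons that msumI[of 0 "closed_segment 0 a" b "zonotope as"] by auto
  ultimately show ?case by auto
qed simp

lemma zonotope_subset_span: "zonotope as \<subseteq> span (set as)"
proof (induction as)
  case (Cons a as)
  have "closed_segment 0 a \<subseteq> span (set (a # as))"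
    by (intro closed_segment_subset subspace_imp_convex subspace_span) (auto simp: span_zero span_base)
  moreover have "zonotope as \<subseteq> span (set (a # as))"
    using Cons span_mono[of "set as" "set (a # as)"] by auto
  ultimately show ?case by (auto simp: msum_def intro: span_add)
qed simp

lemma vol_zonotope_low:
  assumes "length as < DIM('a)"
  shows "vol (zonotope (as :: 'a::euclidean_space list)) = 0"
proof -
  have "dim (zonotope as) \<le> card (set as)"
    using dim_mono[OF zonotope_subset_span[of as]] dim_le_card'[of "set as"] by simp
  also have "\<dots> < DIM('a)" using assms card_length[of as] by simp
  finally have "negligible (zonotope as)" by (rule negligible_lowdim)
  then show ?thesis unfolding vol_def by (rule negligible_imp_measure0)
qed

definition basis_list :: "'a::euclidean_space list \<Rightarrow> bool" where
  "basis_list as \<longleftrightarrow> distinct as \<and> independent (set as) \<and> length as = DIM('a)"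

lemma basis_list_span: "basis_list as \<Longrightarrow> span (set as) = UNIV"
  using card_ge_dim_independent[of "set as" UNIV]
  by (simp add: basis_list_def distinct_card top.extremum_unique)

lemma vol_zonotope_pos:
  assumes "basis_list (as :: 'a::euclidean_space list)"
  shows "0 < vol (zonotope as)"
proof -
  have "span (zonotope as) = UNIV"
    using span_mono[OF set_subset_zonotope[of as]] basis_list_span[OF assms] by auto
  moreover have "affine hull (zonotope as) = span (zonotope as)"
    by (intro affine_hull_span_0 hull_inc zero_in_zonotope)
  ultimately have "aff_dim (zonotope as) = int DIM('a)" by (simp add: aff_dim_eq_full)
  then show ?thesis using vol_eq_0_iff[of "zonotope as"] by (simp add: order_less_le)
qed

section \<open>The leading part of a valuation on zonotopes\<close>

lemma dependent_list_cases:
  assumes "\<not> (distinct as \<and> independent (set as))"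
  obtains a rs where "mset as = mset (a # rs)" "a \<in> span (set rs)"
proof (cases "distinct as")
  case False
  then obtain xs ys zs y where "as = xs @ [y] @ ys @ [y] @ zs" using not_distinct_decomp by blast
  then show thesis by (intro that[of y "xs @ ys @ [y] @ zs"]) (auto intro: span_base)
next
  case True
  then obtain a where a: "a \<in> set as" "a \<in> span (set as - {a})" using assms by (auto simp: dependent_def)
  then show thesis using True by (intro that[of a "remove1 a as"]) auto
qed

text \<open>Applied to the volume with z = 0, and to a support function of the images with z its
  value at {0}. The difference D on N generators obeys the rules of an absolute determinant:
  homogeneity in each vector, invariance under shears, vanishing on dependent lists. Keeping N
  general permits induction on the number of generators.\<close>

locale vanishing_below =
  fixes f :: "'a::euclidean_space set \<Rightarrow> real" and N :: nat and C z :: real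
  assumes val: "real_valuation f"
    and bdd: "\<And>K. convex_body K \<Longrightarrow> C \<le> f K"
    and low: "\<And>as. length as < N \<Longrightarrow> f (zonotope as) = z"
begin

definition D :: "'a list \<Rightarrow> real" where
  "D as = f (zonotope as) - z"

lemma D_mset: "mset xs = mset ys \<Longrightarrow> D xs = D ys"
  using zonotope_mset[of xs ys] by (simp add: D_def)

lemma D_uminus: "D (- a # as) = D (a # as)"
proof -
  have "closed_segment 0 (- a) = closed_segment 0 a \<oplus> {- a}"
    using closed_segment_translation[of "- a" 0 a]
    by (simp add: msum_singleton closed_segment_commute add.commute)
  then have "zonotope (- a # as) = zonotope (a # as) \<oplus> {- a}"
    by (simp add: msum_assoc) (simp add: msum_commute)
  then show ?thesis
    using real_valuation_translation[OF val, of "zonotope (a # as)"] by (simp add: D_def del: simplex_sum.simps list.map)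
qed

lemma D_scaleR:
  assumes N: "length (a # as) = N"
  shows "D (r *\<^sub>R a # as) = \<bar>r\<bar> * D (a # as)"
proof -
  have "D (s *\<^sub>R a # as) = s * D (a # as)" if "0 \<le> s" for s
    using valuation_add_segment(1)[OF val bdd, of "zonotope as" s a] that low[of as] N
    by (simp add: D_def msum_commute)
  from this[of r] this[of "- r"] show ?thesis
    using D_uminus[of "r *\<^sub>R a" as] by (cases "0 \<le> r") auto
qed

text \<open>The diagonal [0, a + c] cuts the parallelogram into two triangles.\<close>

lemma parallelogram:
  assumes R: "convex_body R"
  shows "f (R \<oplus> (closed_segment 0 a \<oplus> closed_segment 0 c)) + f (R \<oplus> closed_segment 0 (a + c))
       = f (R \<oplus> path_simplex [a, c]) + f (R \<oplus> path_simplex [c, a])"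
proof -
  have "prism_rest a [] [c] = {0, c} \<oplus> ({0} \<union> {a})"
    unfolding msum_Un by (auto simp: prism_rest_def msum_singleton)
  then have "convex hull (prism_rest a [] [c]) = closed_segment 0 a \<oplus> closed_segment 0 c"
    by (simp add: convex_hull_msum segment_convex_hull msum_commute insert_commute)
  moreover have "convex hull (prism_rest a [c] []) = path_simplex [c, a]"
    by (simp add: prism_rest_def path_simplex_def insert_commute)
  ultimately show ?thesis
    using prism_step[OF val R, of a "[]" c "[]"] by (simp add: add.commute)
qed

text \<open>The parallelograms on a, b and on a + b, -b have the same two halves up to translation.
  On their diagonals f is z, since a diagonal together with \<open>as\<close> makes only N - 1
  generators.\<close>

lemma D_shear1:
  assumes N: "length (a # b # as) = N"
  shows "D ((a + b) # b # as) = D (a # b # as)"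
proof -
  define R where "R = zonotope as"
  have R: "convex_body R" by (simp add: R_def)
  have *: "f (R \<oplus> closed_segment 0 c) = z" for c
    using low[of "c # as"] N by (simp add: R_def msum_commute)
  have D2: "D (x # y # as) = f (R \<oplus> (closed_segment 0 x \<oplus> closed_segment 0 y)) - z" for x y
    by (simp add: D_def R_def msum_assoc msum_commute msum_left_commute)
  have "path_simplex [a + b, - b] = path_simplex [a, b]"
    by (simp add: path_simplex_def insert_commute)
  moreover have "path_simplex [- b, a + b] = path_simplex [b, a] \<oplus> {- b}"
  proof -
    have "partial_sums [- b, a + b] = partial_sums [b, a] \<oplus> {- b}"
      by (auto simp: msum_singleton)
    then show ?thesis unfolding path_simplex_def by (simp only: convex_hull_msum convex_hull_singleton)
  qed
  then have "f (R \<oplus> path_simplex [- b, a + b]) = f (R \<oplus> path_simplex [b, a])"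
    using real_valuation_translation[OF val, of "R \<oplus> path_simplex [b, a]"] R
    by (simp add: msum_assoc[symmetric])
  ultimately have "D ((a + b) # - b # as) = D (a # b # as)"
    using parallelogram[OF R, of "a + b" "- b"] parallelogram[OF R, of a b] by (simp add: D2 *)
  moreover have "D ((a + b) # - b # as) = D ((a + b) # b # as)"
    using D_uminus[of b "(a + b) # as"] D_mset[of "(a + b) # - b # as" "- b # (a + b) # as"]
      D_mset[of "(a + b) # b # as" "b # (a + b) # as"] by simp
  ultimately show ?thesis by simp
qed

text \<open>For nonzero r, replace b by r b, shear by the whole vector and cancel the factor
  |r|.\<close>

lemma D_shear2:
  assumes N: "length (a # b # as) = N"
  shows "D ((a + r *\<^sub>R b) # b # as) = D (a # b # as)"
proof (cases "r = 0")
  case False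
  have "D (x # r *\<^sub>R b # as) = \<bar>r\<bar> * D (x # b # as)" for x
    using D_scaleR[of b "x # as" r] N D_mset[of "x # r *\<^sub>R b # as" "r *\<^sub>R b # x # as"]
      D_mset[of "x # b # as" "b # x # as"] by simp
  then show ?thesis using D_shear1[of a "r *\<^sub>R b" as] N False by simp
qed simp

lemma D_shear:
  assumes N: "length (a # as) = N" and y: "y \<in> span (set as)"
  shows "D ((a + y) # as) = D (a # as)"
  using y
proof (induction rule: span_induct_alt)
  case base
  then show ?case by simp
next
  case (step c x y)
  have "mset as = mset (x # remove1 x as)" using step by simp
  then have *: "D (u # as) = D (u # x # remove1 x as)" for u by (intro D_mset) simp
  have "length (x # remove1 x as) = length as" using step length_pos_if_in_set[of x as] by (simp add: length_remove1)
  then have "D (((a + y) + c *\<^sub>R x) # as) = D ((a + y) # as)"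
    unfolding * using N by (intro D_shear2) simp
  then show ?case using step by (simp add: add_ac)
qed

text \<open>A shear turns a dependent vector into 0, which leaves a zonotope with N - 1
  generators.\<close>

lemma D_dependent:
  assumes N: "length as = N" and dep: "\<not> (distinct as \<and> independent (set as))"
  shows "D as = 0"
proof -
  obtain a rs where a: "mset as = mset (a # rs)" "a \<in> span (set rs)"
    using dependent_list_cases[OF dep] .
  have "length (a # rs) = N" using N mset_eq_length[OF a(1)] by simp
  then have "D ((0 + a) # rs) = D (0 # rs)" using a(2) by (intro D_shear) auto
  also have "\<dots> = 0" using low[of rs] \<open>length (a # rs) = N\<close> by (simp add: D_def)
  finally show ?thesis using D_mset[OF a(1)] by simp
qed

end

lemma vanishing_below_vol: "vanishing_below (vol :: 'a::euclidean_space set \<Rightarrow> real) DIM('a) 0 0"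
  by (rule vanishing_below.intro) (auto simp: real_valuation_vol vol_zonotope_low)

text \<open>Steinitz exchange, with the remainder y placed where a shear can remove it.\<close>

lemma exchange_basis_list:
  assumes as: "basis_list (a # rs)" and e: "basis_list es" and a: "a \<notin> set es"
  obtains b t y where "b \<in> set es" "b \<notin> set (a # rs)" "basis_list (b # rs)" "y \<in> span (set rs)" "a = t *\<^sub>R b + y"
proof -
  have rs: "independent (set rs)" "distinct rs" "length rs = DIM('a) - 1" "a \<notin> span (set rs)"
    using as by (auto simp: basis_list_def independent_insert dependent_mono split: if_splits)
  have "\<exists>b\<in>set es. b \<notin> span (set rs)"
  proof (rule ccontr)
    assume "\<not> ?thesis"
    then have "span (set es) \<subseteq> span (set rs)" by (intro span_minimal) auto
    then show False using basis_list_span[OF e] rs(4) by auto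
  qed
  then obtain b where b: "b \<in> set es" "b \<notin> span (set rs)" by auto
  then have b2: "b \<notin> set (a # rs)" using a span_base[of _ "set rs"] by auto
  have bl: "basis_list (b # rs)"
    using b b2 rs by (auto simp: basis_list_def independent_insert Suc_diff_1)
  then have "a \<in> span (insert b (set rs))" using basis_list_span[OF bl] by simp
  then obtain t where "a - t *\<^sub>R b \<in> span (set rs)" by (auto simp: span_insert)
  then show thesis using that[OF b(1) b2 bl, of "a - t *\<^sub>R b" t] by simp
qed

lemma (in vanishing_below) D_scaleR_list:
  assumes "length as + length bs = N" "0 \<le> r"
  shows "D (map ((*\<^sub>R) r) as @ bs) = r ^ length as * D (as @ bs)"
  using assms(1)
proof (induction as arbitrary: bs)
  case (Cons a as)
  have "D (map ((*\<^sub>R) r) (a # as) @ bs) = r * D (a # map ((*\<^sub>R) r) as @ bs)"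
    using D_scaleR[of a "map ((*\<^sub>R) r) as @ bs" r] Cons.prems assms(2) by simp
  also have "D (a # map ((*\<^sub>R) r) as @ bs) = D (map ((*\<^sub>R) r) as @ a # bs)"
    by (rule D_mset) simp
  also have "\<dots> = r ^ length as * D (as @ a # bs)" using Cons by simp
  also have "D (as @ a # bs) = D ((a # as) @ bs)" by (rule D_mset) simp
  finally show ?case by simp
qed simp

text \<open>Exchanging a = t b + y for b changes D and the volume by the same factor |t|, so
  proportionality can be carried back from e. The induction counts the vectors not yet in e.\<close>

lemma (in vanishing_below) D_proportional_vol:
  assumes N: "N = DIM('a)" and e: "basis_list e" and len: "length as = DIM('a)"
  shows "D as * vol (zonotope e) = D e * vol (zonotope as)"
proof -
  interpret V: vanishing_below "vol :: 'a set \<Rightarrow> real" "DIM('a)" 0 0 by (rule vanishing_below_vol)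
  have V: "V.D xs = vol (zonotope xs)" for xs by (simp add: V.D_def)
  show ?thesis
  proof (cases "basis_list as")
    case False
    then have "\<not> (distinct as \<and> independent (set as))" using len by (simp add: basis_list_def)
    then show ?thesis using D_dependent V.D_dependent V N len by simp
  next
    case True
    then show ?thesis
    proof (induction "card (set as - set e)" arbitrary: as rule: less_induct)
      case less
      show ?case
      proof (cases "set as \<subseteq> set e")
        case True
        then have "set as = set e"
          using less.prems e by (intro card_subset_eq) (auto simp: basis_list_def distinct_card)
        then have "mset as = mset e"
          using less.prems e by (simp add: basis_list_def set_eq_iff_mset_eq_distinct)
        then show ?thesis using D_mset zonotope_mset by metis
      next
        case False
        then obtain a where a: "a \<in> set as" "a \<notin> set e" by auto
        define rs where "rs = remove1 a as"
        have ms: "mset as = mset (a # rs)" using a by (simp add: rs_def)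
        have bl: "basis_list (a # rs)"
          using less.prems ms unfolding basis_list_def
          by (metis mset_eq_imp_distinct_iff mset_eq_length mset_eq_setD)
        obtain b t y where b: "b \<in> set e" "b \<notin> set (a # rs)" "basis_list (b # rs)" "y \<in> span (set rs)"
          "a = t *\<^sub>R b + y"
          using exchange_basis_list[OF bl e a(2)] by blast
        have len': "length (b # rs) = DIM('a)" "length (t *\<^sub>R b # rs) = DIM('a)"
          using b(3) by (auto simp: basis_list_def)
        have "set (b # rs) - set e \<subset> set as - set e"
        proof -
          have "set as = insert a (set rs)" using mset_eq_setD[OF ms] by simp
          moreover have "a \<notin> set rs" using bl by (simp add: basis_list_def)
          ultimately show ?thesis using a(2) b(1) by (auto simp: psubset_eq)
        qed
        then have "card (set (b # rs) - set e) < card (set as - set e)"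
          by (intro psubset_card_mono) auto
        then have IH: "D (b # rs) * vol (zonotope e) = D e * vol (zonotope (b # rs))"
          using less.hyps b(3) by blast
        have "D as = \<bar>t\<bar> * D (b # rs)"
          using D_mset[OF ms] D_shear[of "t *\<^sub>R b" rs y] D_scaleR[of b rs t] b(4,5) len' N by simp
        moreover have "V.D as = \<bar>t\<bar> * V.D (b # rs)"
          using V.D_mset[OF ms] V.D_shear[of "t *\<^sub>R b" rs y] V.D_scaleR[of b rs t] b(4,5) len' by simp
        ultimately show ?thesis using IH unfolding V[symmetric] by simp
      qed
    qed
  qed
qed

lemma path_simplex_subset_zonotope: "path_simplex bs \<subseteq> zonotope bs"
  unfolding path_simplex_def
proof (rule hull_minimal)
  show "partial_sums bs \<subseteq> zonotope bs"
  proof (induction bs)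
    case (Cons b bs)
    have "b + x \<in> zonotope (b # bs)" if "x \<in> partial_sums bs" for x
      using Cons that msumI[of b "closed_segment 0 b" x "zonotope bs"] by auto
    moreover have "0 \<in> zonotope (b # bs)" by (rule zero_in_zonotope)
    ultimately show ?case by auto
  qed simp
  show "convex (zonotope bs)" using convex_body_simplex_sum convex_body_def by blast
qed

lemma simplex_sum_subset_zonotope: "simplex_sum bss \<subseteq> zonotope (concat bss)"
proof (induction bss)
  case (Cons b bss)
  then show ?case
    using msum_mono[OF path_simplex_subset_zonotope[of b] Cons] by (simp add: simplex_sum_append)
qed simp

section \<open>Support functions\<close>

definition supp :: "'a::euclidean_space set \<Rightarrow> 'a \<Rightarrow> real" where
  "supp M x = (SUP y\<in>M. y \<bullet> x)"

lemma supp_bdd: "convex_body M \<Longrightarrow> bdd_above ((\<lambda>y. y \<bullet> x) ` M)"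
  unfolding convex_body_def
  by (intro bounded_imp_bdd_above compact_imp_bounded compact_continuous_image continuous_intros) auto

lemma supp_ge: "convex_body M \<Longrightarrow> y \<in> M \<Longrightarrow> y \<bullet> x \<le> supp M x"
  unfolding supp_def by (rule cSUP_upper[OF _ supp_bdd])

lemma supp_le: "M \<noteq> {} \<Longrightarrow> (\<And>y. y \<in> M \<Longrightarrow> y \<bullet> x \<le> b) \<Longrightarrow> supp M x \<le> b"
  unfolding supp_def by (rule cSUP_least)

lemma supp_attained:
  assumes "convex_body M"
  obtains y where "y \<in> M" "y \<bullet> x = supp M x"
proof -
  have "\<exists>y\<in>M. \<forall>z\<in>M. z \<bullet> x \<le> y \<bullet> x"
    using assms by (intro continuous_attains_sup) (auto simp: convex_body_def intro!: continuous_intros)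
  then obtain y where y: "y \<in> M" "\<And>z. z \<in> M \<Longrightarrow> z \<bullet> x \<le> y \<bullet> x" by auto
  have "supp M x \<le> y \<bullet> x" using y by (intro supp_le) auto
  then show thesis using that y(1) supp_ge[OF assms y(1), of x] by (simp add: order_antisym)
qed

lemma supp_msum:
  assumes "convex_body A" "convex_body B"
  shows "supp (A \<oplus> B) x = supp A x + supp B x"
proof (rule order_antisym)
  show "supp (A \<oplus> B) x \<le> supp A x + supp B x"
    using supp_ge[OF assms(1)] supp_ge[OF assms(2)] convex_body_msum[OF assms]
    by (intro supp_le) (auto simp: convex_body_def msum_def inner_add_left intro!: add_mono)
  obtain a where a: "a \<in> A" "a \<bullet> x = supp A x" using supp_attained[OF assms(1)] .
  obtain b where b: "b \<in> B" "b \<bullet> x = supp B x" using supp_attained[OF assms(2)] .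
  show "supp A x + supp B x \<le> supp (A \<oplus> B) x"
    using supp_ge[OF convex_body_msum[OF assms] msumI[OF a(1) b(1)], of x] a b by (simp add: inner_add_left)
qed

lemma supp_mem:
  assumes M: "convex_body M" and y: "\<And>x. y \<bullet> x \<le> supp M x"
  shows "y \<in> M"
proof (rule ccontr)
  assume "y \<notin> M"
  then obtain w b where w: "\<And>c. c \<in> M \<Longrightarrow> w \<bullet> c < b" "b < w \<bullet> y"
    using separated_from_body[OF M, of "{y}"] by auto
  obtain c where "c \<in> M" "c \<bullet> w = supp M w" using supp_attained[OF M] .
  then show False using w(1)[of c] w(2) y[of w] by (simp add: inner_commute)
qed

lemma supp_subset: "convex_body A \<Longrightarrow> convex_body B \<Longrightarrow> (\<And>x. supp A x \<le> supp B x) \<Longrightarrow> A \<subseteq> B"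
  using supp_mem[of B] supp_ge[of A] order_trans by blast

lemma supp_eqI: "convex_body A \<Longrightarrow> convex_body B \<Longrightarrow> (\<And>x. supp A x = supp B x) \<Longrightarrow> A = B"
  by (simp add: supp_subset subset_antisym)

lemma supp_segment: "supp (closed_segment (- v) v) x = \<bar>v \<bullet> x\<bar>"
proof (rule order_antisym)
  have "closed_segment (- v) v \<subseteq> {y. y \<bullet> x \<le> \<bar>v \<bullet> x\<bar>}"
    by (intro closed_segment_subset) (auto simp: convex_halfspace_le inner_commute[of _ x])
  then show "supp (closed_segment (- v) v) x \<le> \<bar>v \<bullet> x\<bar>" by (intro supp_le) auto
  show "\<bar>v \<bullet> x\<bar> \<le> supp (closed_segment (- v) v) x"
    using supp_ge[of "closed_segment (- v) v" v x] supp_ge[of "closed_segment (- v) v" "- v" x] by auto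
qed

lemma scaled_segment:
  "(\<lambda>x. r *\<^sub>R x) ` closed_segment (- v) v = closed_segment (- (r *\<^sub>R v)) (r *\<^sub>R v)"
  using closed_segment_linear_image[of "(*\<^sub>R) r" "- v" v] by (simp add: linear_scale_self)

lemma origin_symmetric_uminus: "origin_symmetric M \<Longrightarrow> y \<in> M \<Longrightarrow> - y \<in> M"
  by (auto simp: origin_symmetric_def)

lemma origin_symmetric_zero:
  assumes "convex_body M" "origin_symmetric M"
  shows "0 \<in> M"
proof -
  obtain y where y: "y \<in> M" using assms by (auto simp: convex_body_def)
  have "(1/2) *\<^sub>R y + (1/2) *\<^sub>R (- y) \<in> M"
    using assms y origin_symmetric_uminus[OF assms(2) y] by (intro convexD) (auto simp: convex_body_def)
  then show ?thesis by simp
qed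

lemma supp_nonneg: "convex_body M \<Longrightarrow> origin_symmetric M \<Longrightarrow> 0 \<le> supp M x"
  using supp_ge[of M 0 x] origin_symmetric_zero[of M] by simp

lemma supp_uminus:
  assumes "convex_body M" "origin_symmetric M"
  shows "supp M (- x) = supp M x"
proof -
  have "supp M (- y) \<le> supp M y" for y
    using supp_ge[OF assms(1), of _ y] origin_symmetric_uminus[OF assms(2)] assms(1)
    by (intro supp_le) (force simp: convex_body_def)+
  from this[of x] this[of "- x"] show ?thesis by simp
qed

lemma zonotope_subset_scaled_body:
  assumes M: "convex M" "0 \<in> M" and as: "set as \<subseteq> M"
  shows "zonotope as \<subseteq> (\<lambda>x. real (length as) *\<^sub>R x) ` M"
  using as
proof (induction as)
  case (Cons a as)
  define k where "k = real (length as)"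
  have k: "0 \<le> k" by (simp add: k_def)
  show ?case
  proof
    fix y assume "y \<in> zonotope (a # as)"
    then obtain s m where y: "s \<in> closed_segment 0 a" "m \<in> M" "y = s + k *\<^sub>R m"
      using Cons by (auto simp: msum_def k_def)
    have "closed_segment 0 a \<subseteq> M" using Cons.prems M by (intro closed_segment_subset) auto
    then have "(1 / (k + 1)) *\<^sub>R s + (k / (k + 1)) *\<^sub>R m \<in> M"
      using M y k by (intro convexD) (auto simp: add_divide_distrib[symmetric] add.commute)
    moreover have "y = (k + 1) *\<^sub>R ((1 / (k + 1)) *\<^sub>R s + (k / (k + 1)) *\<^sub>R m)"
      using k y(3) by (simp add: scaleR_right_distrib)
    ultimately show "y \<in> (\<lambda>x. real (length (a # as)) *\<^sub>R x) ` M" by (auto simp: k_def add.commute)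
  qed
qed (use M in auto)

lemma zonotope_scaleR: "zonotope (map ((*\<^sub>R) r) as) = (\<lambda>x. r *\<^sub>R x) ` zonotope as"
proof (induction as)
  case (Cons a as)
  have "closed_segment 0 (r *\<^sub>R a) = (\<lambda>x. r *\<^sub>R x) ` closed_segment 0 a"
    using closed_segment_linear_image[of "(*\<^sub>R) r" 0 a] by (simp add: linear_scale_self)
  then show ?case using Cons
    by (auto simp: msum_def scaleR_right_distrib image_iff) (metis scaleR_right_distrib)+
qed simp

interpretation vol: vanishing_below "vol :: 'a::euclidean_space set \<Rightarrow> real" "DIM('a)" 0 0
  by (rule vanishing_below_vol)

lemma vol_D: "vol.D as = vol (zonotope as)"
  by (simp add: vol.D_def)

text \<open>Dividing the n vectors by n puts their parallelotope inside M, as M is convex and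
  contains 0; hence the factor n^n.\<close>

lemma vol_body_ge:
  fixes M :: "'a::euclidean_space set"
  assumes M: "convex_body M" "0 \<in> M" and as: "set as \<subseteq> M" "length as = DIM('a)"
  shows "vol (zonotope as) \<le> real DIM('a) ^ DIM('a) * vol M"
proof -
  define n where "n = DIM('a)"
  have n: "0 < real n" by (simp add: n_def)
  have "zonotope (map ((*\<^sub>R) (1 / real n)) as) \<subseteq> M"
    unfolding zonotope_scaleR
    using zonotope_subset_scaled_body[of M as] M as n by (auto simp: convex_body_def n_def)
  then have "vol (zonotope (map ((*\<^sub>R) (1 / real n)) as)) \<le> vol M"
    using M by (intro vol_mono) auto
  moreover have "vol (zonotope (map ((*\<^sub>R) (1 / real n)) as)) = (1 / real n) ^ n * vol (zonotope as)"
    using vol.D_scaleR_list[of as "[]" "1 / real n"] as(2) by (simp add: vol_D n_def)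
  ultimately have "(1 / real n) ^ n * vol (zonotope as) \<le> vol M" by linarith
  then have "real n ^ n * ((1 / real n) ^ n * vol (zonotope as)) \<le> real n ^ n * vol M"
    by (intro mult_left_mono) auto
  moreover have "real n ^ n * (1 / real n) ^ n = 1"
    using n by (simp add: power_mult_distrib[symmetric])
  ultimately show ?thesis unfolding n_def[symmetric] by (simp add: mult.assoc[symmetric])
qed

text \<open>For k > 0 the body M k / k has support function h / k + g. Its support points in
  direction x stay bounded, and w is a limit of a subsequence. Such a w is a direction of growth: k
  w lies in M k because h is nonnegative.\<close>

lemma asymptotic_support_point:
  fixes M :: "nat \<Rightarrow> 'a::euclidean_space set"
  assumes M: "\<And>k. convex_body (M k)"
    and supp: "\<And>k y. supp (M k) y = h y + real k * g y"
    and h: "\<And>y. 0 \<le> h y"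
  obtains w where "w \<bullet> x = g x" "\<And>y. w \<bullet> y \<le> g y"
proof -
  have "\<exists>p. p \<in> M (Suc k) \<and> p \<bullet> x = h x + real (Suc k) * g x" for k
    using supp_attained[OF M, of "Suc k" x] supp by metis
  then obtain p where p: "\<And>k. p k \<in> M (Suc k)" "\<And>k. p k \<bullet> x = h x + real (Suc k) * g x" by metis
  define q where "q k = (1 / real (Suc k)) *\<^sub>R p k" for k
  have qx: "q k \<bullet> x = h x / real (Suc k) + g x" for k
    using p(2)[of k] by (simp add: q_def add_divide_distrib del: of_nat_Suc)
  have qy: "q k \<bullet> y \<le> h y / real (Suc k) + g y" for k y
  proof -
    have "p k \<bullet> y \<le> h y + real (Suc k) * g y" using supp_ge[OF M p(1)[of k], of y] supp by simp
    then have "p k \<bullet> y / real (Suc k) \<le> (h y + real (Suc k) * g y) / real (Suc k)"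
      by (intro divide_right_mono) auto
    then show ?thesis by (simp add: q_def add_divide_distrib del: of_nat_Suc)
  qed
  have hb: "h y / real (Suc k) \<le> h y" for k y
    using h[of y] by (simp add: divide_le_eq mult_le_cancel_left1)
  have "norm (q k) \<le> (\<Sum>b\<in>Basis. \<bar>h b + g b\<bar> + \<bar>h (- b) + g (- b)\<bar>)" for k
  proof -
    have "\<bar>q k \<bullet> b\<bar> \<le> \<bar>h b + g b\<bar> + \<bar>h (- b) + g (- b)\<bar>" for b
      using qy[of k b] qy[of k "- b"] hb[of b k] hb[of "- b" k] by (simp add: abs_le_iff) linarith
    then show ?thesis using norm_le_l1[of "q k"] by (meson order_trans sum_mono)
  qed
  then have "bounded (range q)" by (auto simp: bounded_iff)
  then obtain w r where wr: "strict_mono r" "(q \<circ> r) \<longlonglongrightarrow> w"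
    using bounded_imp_convergent_subsequence by blast
  have lim: "(\<lambda>k. h y / real (Suc (r k)) + g y) \<longlonglongrightarrow> g y" for y
  proof -
    have "(\<lambda>k. h y / real (Suc k)) \<longlonglongrightarrow> 0"
      by (rule LIMSEQ_Suc, rule lim_const_over_n)
    then have "(\<lambda>k. h y / real (Suc (r k))) \<longlonglongrightarrow> 0"
      using LIMSEQ_subseq_LIMSEQ[OF _ wr(1)] by (force simp: o_def)
    then show ?thesis using tendsto_add[OF _ tendsto_const, of _ 0 _ "g y"] by fastforce
  qed
  have qlim: "(\<lambda>k. q (r k) \<bullet> y) \<longlonglongrightarrow> w \<bullet> y" for y
    using tendsto_inner[OF wr(2) tendsto_const, of y] by (simp add: o_def)
  show thesis
  proof
    show "w \<bullet> x = g x" using LIMSEQ_unique[OF qlim[of x]] lim[of x] by (simp add: qx)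
    show "w \<bullet> y \<le> g y" for y by (rule LIMSEQ_le[OF qlim lim]) (use qy in auto)
  qed
qed

lemma hyperplane_contains:
  fixes L :: "'a::euclidean_space set"
  assumes "0 \<in> L" "aff_dim L = int DIM('a) - 1"
  obtains u where "u \<noteq> 0" "span L = {x. u \<bullet> x = 0}"
proof -
  have d: "dim L = DIM('a) - 1" "dim L < DIM('a)"
    using assms by (auto simp: aff_dim_zero hull_inc)
  then obtain u where u: "u \<noteq> 0" "span L \<subseteq> {x. u \<bullet> x = 0}"
    using lowdim_subset_hyperplane by blast
  have "span L = {x. u \<bullet> x = 0}"
    using u d by (intro subspace_dim_equal) (auto simp: subspace_hyperplane dim_hyperplane)
  then show thesis using that u(1) by blast
qed

text \<open>Supplies parallelotopes with prescribed first generators and all others in L, which will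
  be the image of {0} and hence contained in the images of all zonotopes.\<close>

lemma extend_to_basis_list:
  assumes "distinct ws" "independent (set ws)" "span (set ws \<union> L) = (UNIV :: 'a::euclidean_space set)"
  obtains rs where "basis_list (ws @ rs)" "set rs \<subseteq> L"
proof -
  obtain B where B: "set ws \<subseteq> B" "B \<subseteq> set ws \<union> L" "independent B" "set ws \<union> L \<subseteq> span B"
    using maximal_independent_subset_extend[of "set ws" "set ws \<union> L"] assms(2) by auto
  have "finite B" using B(3) by (rule independent_imp_finite)
  then obtain rs where rs: "set rs = B - set ws" "distinct rs"
    using finite_distinct_list[of "B - set ws"] by auto
  have set: "set (ws @ rs) = B" using rs B(1) by auto
  have dist: "distinct (ws @ rs)" using rs assms(1) by auto
  have "span B = UNIV"
    using span_minimal[OF B(4) subspace_span] assms(3) by auto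
  then have "card B = DIM('a)"
    using dim_eq_card[of B UNIV] B(3) by (metis dim_UNIV span_UNIV)
  then have "length (ws @ rs) = DIM('a)" using distinct_card[OF dist] set by simp
  then have "basis_list (ws @ rs)" using dist set B(3) by (simp add: basis_list_def)
  then show thesis using that rs B(2) by blast
qed

section \<open>Valuations satisfying the volume condition\<close>

text \<open>The support value at u measures the height of an image above the hyperplane spanned by
  the image of {0}.\<close>

locale vc_valuation =
  fixes \<Phi> :: "'a::euclidean_space set \<Rightarrow> 'a set" and cl cu :: real and u :: 'a
  assumes body: "convex_body K \<Longrightarrow> convex_body (\<Phi> K)"
    and mval: "minkowski_valuation \<Phi>"
    and tinv: "translation_invariant \<Phi>"
    and sym: "convex_body K \<Longrightarrow> origin_symmetric (\<Phi> K)"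
    and cl: "0 < cl"
    and vol_lower: "convex_body K \<Longrightarrow> cl * vol K \<le> vol (\<Phi> K)"
    and vol_upper: "convex_body K \<Longrightarrow> vol (\<Phi> K) \<le> cu * vol K"
    and u: "u \<noteq> 0" "span (\<Phi> {0}) = {x. u \<bullet> x = 0}"
    and dim2: "2 \<le> DIM('a)"
begin

definition h :: "'a \<Rightarrow> 'a set \<Rightarrow> real" where
  "h x K = supp (\<Phi> K) x"

lemma real_valuation_h: "real_valuation (h x)"
  unfolding real_valuation_def
proof (intro conjI allI impI)
  fix K L :: "'a set" assume *: "convex_body K \<and> convex_body L \<and> convex (K \<union> L)"
  then have "convex_body (K \<union> L)" "convex_body (K \<inter> L)"
    by (auto intro: convex_body_Un convex_body_Int)
  moreover from this have "\<Phi> K \<oplus> \<Phi> L = \<Phi> (K \<union> L) \<oplus> \<Phi> (K \<inter> L)"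
    using mval * by (auto simp: minkowski_valuation_def)
  ultimately show "h x K + h x L = h x (K \<union> L) + h x (K \<inter> L)"
    using * body by (simp add: h_def flip: supp_msum)
qed (use tinv in \<open>auto simp: h_def translation_invariant_def\<close>)

lemma h_nonneg: "convex_body K \<Longrightarrow> 0 \<le> h x K"
  unfolding h_def by (intro supp_nonneg body sym)

lemma h_uminus: "convex_body K \<Longrightarrow> h (- x) K = h x K"
  unfolding h_def by (intro supp_uminus body sym)

lemma zero_in: "convex_body K \<Longrightarrow> 0 \<in> \<Phi> K"
  by (intro origin_symmetric_zero body sym)

lemma h_u_zero: "h u {0} = 0"
proof -
  obtain y where y: "y \<in> \<Phi> {0}" "y \<bullet> u = h u {0}"
    using supp_attained[OF body[of "{0}"]] by (auto simp: h_def)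
  then have "y \<in> span (\<Phi> {0})" by (simp add: span_base)
  then show ?thesis using u y(2) by (simp add: inner_commute)
qed

lemma h_mono: "convex_body K \<Longrightarrow> h x K \<le> h x (K \<oplus> zonotope bs)"
proof (induction bs)
  case (Cons b bs)
  have "h x (K \<oplus> zonotope bs) \<le> h x ((K \<oplus> zonotope bs) \<oplus> closed_segment 0 b)"
    using valuation_add_segment(2)[OF real_valuation_h h_nonneg] Cons.prems by simp
  then show ?case using Cons by (simp add: msum_commute msum_left_commute)
qed simp

lemma h_zero_le: "h x {0} \<le> h x (zonotope bs)"
  using h_mono[of "{0}" x bs] by simp

lemma contains_zero_image: "\<Phi> {0} \<subseteq> \<Phi> (zonotope bs)"
  using h_zero_le[of _ bs] by (intro supp_subset body) (auto simp: h_def)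

lemma span_with_transversal:
  assumes "p \<in> S" "\<Phi> {0} \<subseteq> S" "u \<bullet> p \<noteq> 0"
  shows "span S = UNIV"
proof -
  have "z \<in> span S" for z
  proof -
    define t where "t = (u \<bullet> z) / (u \<bullet> p)"
    have "u \<bullet> (z - t *\<^sub>R p) = 0" using assms(3) by (simp add: t_def inner_diff_right)
    then have "z - t *\<^sub>R p \<in> span (\<Phi> {0})" using u by simp
    then have "z - t *\<^sub>R p \<in> span S" using span_mono[OF assms(2)] by blast
    moreover have "t *\<^sub>R p \<in> span S" using assms(1) by (intro span_scale span_base)
    ultimately have "(z - t *\<^sub>R p) + t *\<^sub>R p \<in> span S" by (rule span_add)
    then show ?thesis by simp
  qed
  then show ?thesis by auto
qed

lemma vol_image_ge:
  assumes "convex_body K" "set as \<subseteq> \<Phi> K" "length as = DIM('a)"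
  shows "vol (zonotope as) \<le> real DIM('a) ^ DIM('a) * (cu * vol K)"
proof -
  have "vol (zonotope as) \<le> real DIM('a) ^ DIM('a) * vol (\<Phi> K)"
    using assms by (intro vol_body_ge body zero_in)
  also have "\<dots> \<le> real DIM('a) ^ DIM('a) * (cu * vol K)"
    using vol_upper[OF assms(1)] by (intro mult_left_mono) auto
  finally show ?thesis .
qed

text \<open>A point of the image off the hyperplane spans, together with the image of {0}, a
  parallelotope of positive volume, against the upper bound in (VC).\<close>

lemma h_u_flat:
  assumes "vol (zonotope as) = 0"
  shows "h u (zonotope as) = 0"
proof (rule ccontr)
  assume *: "h u (zonotope as) \<noteq> 0"
  obtain p where p: "p \<in> \<Phi> (zonotope as)" "p \<bullet> u = h u (zonotope as)"
    unfolding h_def by (rule supp_attained[OF body[OF convex_body_simplex_sum]])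
  have pu: "u \<bullet> p \<noteq> 0" using * p(2) by (simp add: inner_commute)
  then have "span (set [p] \<union> \<Phi> {0}) = UNIV" by (intro span_with_transversal) auto
  moreover have "p \<noteq> 0" using pu by auto
  ultimately obtain rs where rs: "basis_list ([p] @ rs)" "set rs \<subseteq> \<Phi> {0}"
    using extend_to_basis_list[of "[p]" "\<Phi> {0}"] by (auto simp: independent_insert)
  have "vol (zonotope ([p] @ rs)) \<le> real DIM('a) ^ DIM('a) * (cu * vol (zonotope as))"
    using p rs contains_zero_image[of as] by (intro vol_image_ge) (auto simp: basis_list_def)
  then show False using vol_zonotope_pos[OF rs(1)] assms by simp
qed

text \<open>Without height the image lies in the hyperplane, against the lower bound in
  (VC).\<close>

lemma h_u_pos:
  assumes "0 < vol (zonotope as)"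
  shows "0 < h u (zonotope as)"
proof (rule ccontr)
  let ?M = "\<Phi> (zonotope as)"
  assume "\<not> 0 < h u (zonotope as)"
  then have "h u (zonotope as) = 0" using h_nonneg[of "zonotope as" u] by simp
  then have "y \<bullet> u \<le> 0" "- y \<bullet> u \<le> 0" if "y \<in> ?M" for y
    using that supp_ge[OF body, of "zonotope as" y u] supp_ge[OF body, of "zonotope as" "- y" u]
      origin_symmetric_uminus[OF sym, of "zonotope as"] by (auto simp: h_def)
  then have "?M \<subseteq> {y. u \<bullet> y = 0}" by (force simp: inner_commute)
  then have "negligible ?M" using negligible_hyperplane[of u 0] u(1) negligible_subset by blast
  then have "vol ?M = 0" unfolding vol_def by (rule negligible_imp_measure0)
  then show False using vol_lower[of "zonotope as"] cl assms mult_pos_pos[OF cl assms] by simp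
qed

lemma h_zonotope_scale:
  assumes "0 \<le> r"
  shows "h x (zonotope (r *\<^sub>R a # as)) = h x (zonotope as) + r * (h x (zonotope (a # as)) - h x (zonotope as))"
  using valuation_add_segment(1)[OF real_valuation_h h_nonneg, of "zonotope as" r x a] assms
  by (simp add: msum_commute)

lemma no_linear_square_bound:
  assumes "0 < b" "\<And>k::nat. real k * (real k * b) \<le> real k * c"
  shows False
proof -
  obtain k :: nat where k: "c < real k * b" using reals_Archimedean3[OF assms(1)] by blast
  show False
  proof (cases "k = 0")
    case True
    then show False using k assms(2)[of 1] assms(1) by simp
  next
    case False
    then have "real k * b \<le> c" using assms(2)[of k] by simp
    then show False using k by simp
  qed
qed

text \<open>Otherwise the images of \<open>[0, k a] + \<dots>\<close> contain, besides \<open>\<Phi> {0}\<close>, a vector \<open>k w\<close> parallel to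
  it and a vector whose height over the hyperplane of \<open>\<Phi> {0}\<close> is of order \<open>k\<close>. So their volume is of
  order \<open>k\<^sup>2\<close>, against the upper bound of order \<open>k\<close>.\<close>

lemma h_zonotope_low:
  assumes "length as < DIM('a)"
  shows "h x (zonotope as) = h x {0}"
  using assms
proof (induction "length as" arbitrary: as x rule: less_induct)
  case less
  \<comment> \<open>By induction the support values are constant on zonotopes with fewer generators,
    so the determinant rules hold at this length and dispose of dependent lists.\<close>
  have VB: "vanishing_below (h x) (length as) 0 (h x {0})" for x
    using less.hyps less.prems by (intro vanishing_below.intro real_valuation_h h_nonneg) auto
  show ?case
  proof (cases "as = [] \<or> \<not> (distinct as \<and> independent (set as))")
    case True
    then show ?thesis
      using vanishing_below.D_dependent[OF VB[of x], of as] vanishing_below.D_def[OF VB[of x], of as] by auto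
  next
    case False
    then obtain a as' where as: "as = a # as'" by (cases as) auto
    define D where "D y = h y (zonotope as) - h y {0}" for y
    have D: "0 \<le> D y" for y using h_zero_le[of y as] by (simp add: D_def)
    have scale: "h y (zonotope (real k *\<^sub>R a # as')) = h y {0} + real k * D y" for y k
      using h_zonotope_scale[of "real k" y a as'] less.hyps[of as' y] less.prems as by (simp add: D_def)
    show ?thesis
    proof (rule ccontr)
      assume neq: "h x (zonotope as) \<noteq> h x {0}"
      obtain w where w: "w \<bullet> x = D x" "\<And>y. w \<bullet> y \<le> D y"
        by (rule asymptotic_support_point[of "\<lambda>k. \<Phi> (zonotope (real k *\<^sub>R a # as'))" "\<lambda>y. h y {0}" D x])
          (use scale h_nonneg in \<open>auto simp: h_def intro!: body\<close>)
      \<comment> \<open>Flat zonotopes have images of height 0, so the growth vector w is parallel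
        to the hyperplane.\<close>
      have "D u = 0" using h_u_flat[of as] vol_zonotope_low[OF less.prems] by (simp add: D_def h_u_zero)
      moreover have "D (- u) = D u" by (simp add: D_def h_uminus)
      ultimately have wu: "u \<bullet> w = 0" using w(2)[of u] w(2)[of "- u"] by (simp add: inner_commute)
      have w0: "w \<noteq> 0" using w(1) neq by (auto simp: D_def)
      \<comment> \<open>Completing to a basis gives a zonotope of positive volume, whose image has
        positive height.\<close>
      obtain bs where bs: "basis_list (as @ bs)"
        using extend_to_basis_list[of as UNIV] False by auto
      define V where "V = vol (zonotope (as @ bs))"
      have len: "length (as' @ bs) < DIM('a)" using bs as by (simp add: basis_list_def)
      define \<eta> where "\<eta> = h u (zonotope (as @ bs))"
      have \<eta>: "0 < \<eta>" unfolding \<eta>_def by (intro h_u_pos vol_zonotope_pos bs)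
      define K where "K k = zonotope (real k *\<^sub>R a # as' @ bs)" for k :: nat
      have zero_sub: "\<Phi> {0} \<subseteq> \<Phi> (K k)" for k unfolding K_def by (rule contains_zero_image)
      \<comment> \<open>Without the generator a the zonotope is flat and its image has height 0, so
        the height is exactly proportional to k.\<close>
      have hK: "h u (K k) = real k * \<eta>" for k
        using h_zonotope_scale[of "real k" u a "as' @ bs"] h_u_flat[OF vol_zonotope_low[OF len]]
        by (simp add: K_def \<eta>_def as)
      have volK: "vol (K k) = real k * V" for k
        using vol.D_scaleR[of a "as' @ bs" "real k"] bs by (simp add: vol_D K_def V_def as basis_list_def)
      have "pairwise orthogonal {w, u}"
        using wu by (auto simp: pairwise_def orthogonal_def inner_commute)
      then have "independent (set [w, u])" using w0 u(1) pairwise_orthogonal_independent[of "{w, u}"] by simp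
      moreover have "distinct [w, u]" using wu u(1) by auto
      moreover have "span (set [w, u] \<union> \<Phi> {0}) = UNIV"
        using u(1) by (intro span_with_transversal[of u]) auto
      ultimately obtain rs where rs: "basis_list ([w, u] @ rs)" "set rs \<subseteq> \<Phi> {0}"
        using extend_to_basis_list[of "[w, u]" "\<Phi> {0}"] by blast
      define W where "W = vol.D (u # w # rs)"
      have "W = vol (zonotope ([w, u] @ rs))"
        unfolding W_def vol_D by (intro arg_cong[of _ _ vol] zonotope_mset) simp
      then have W: "0 < W" using vol_zonotope_pos[OF rs(1)] by simp
      have lenrs: "length (u # w # rs) = DIM('a)" using rs(1) by (simp add: basis_list_def)
      \<comment> \<open>Since w and rs span the hyperplane, a shear will replace p by its normal
        component.\<close>
      have hyper: "y \<in> span (set (w # rs))" if y: "u \<bullet> y = 0" for y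
      proof -
        have "y \<in> span (insert u (set (w # rs)))"
          using basis_list_span[OF rs(1)] by (simp add: insert_commute)
        then obtain t where t: "y - t *\<^sub>R u \<in> span (set (w # rs))" by (auto simp: span_breakdown_eq)
        have "set (w # rs) \<subseteq> span (\<Phi> {0})"
          using rs(2) wu u(2) span_superset[of "\<Phi> {0}"] by auto
        then have "span (set (w # rs)) \<subseteq> span (\<Phi> {0})" by (intro span_minimal subspace_span)
        then have "u \<bullet> (y - t *\<^sub>R u) = 0" using t u(2) by auto
        then have "t = 0" using y u(1) by (simp add: inner_diff_right)
        then show ?thesis using t by simp
      qed
      have "real k * (real k * (\<eta> / (u \<bullet> u) * W)) \<le> real k * (real DIM('a) ^ DIM('a) * (cu * V))" for k
      proof -
        have cK: "convex_body (K k)" by (simp add: K_def del: simplex_sum.simps list.map)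
        obtain p where p: "p \<in> \<Phi> (K k)" "p \<bullet> u = real k * \<eta>"
          using supp_attained[OF body[OF cK], of u] hK[of k] by (auto simp: h_def)
        have "h y (zonotope (real k *\<^sub>R a # as')) \<le> h y (K k)" for y
          using h_mono[of "zonotope (real k *\<^sub>R a # as')" y bs]
          by (simp add: K_def simplex_sum_append msum_assoc)
        moreover have "real k *\<^sub>R w \<bullet> y \<le> h y (zonotope (real k *\<^sub>R a # as'))" for y
          using mult_left_mono[OF w(2)[of y], of "real k"] h_nonneg[of "{0}" y] unfolding scale by simp
        ultimately have "real k *\<^sub>R w \<bullet> y \<le> h y (K k)" for y
          using order_trans by blast
        then have kw: "real k *\<^sub>R w \<in> \<Phi> (K k)" by (intro supp_mem body[OF cK]) (simp add: h_def)
        define \<alpha> where "\<alpha> = real k * \<eta> / (u \<bullet> u)"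
        have \<alpha>0: "0 \<le> \<alpha>" using \<eta> by (simp add: \<alpha>_def)
        have "u \<bullet> (p - \<alpha> *\<^sub>R u) = 0"
          using p(2) u(1) by (simp add: \<alpha>_def inner_diff_right inner_commute[of u p])
        then have "vol.D ((\<alpha> *\<^sub>R u + (p - \<alpha> *\<^sub>R u)) # w # rs) = vol.D (\<alpha> *\<^sub>R u # w # rs)"
          using lenrs by (intro vol.D_shear hyper) auto
        also have "\<dots> = \<alpha> * W"
          using vol.D_scaleR[of u "w # rs" \<alpha>] lenrs \<alpha>0 by (simp add: W_def)
        finally have "vol.D (p # w # rs) = \<alpha> * W" by (simp only: add_diff_eq add_diff_cancel_left')
        moreover have "vol.D (p # real k *\<^sub>R w # rs) = real k * vol.D (p # w # rs)"
          using vol.D_scaleR[of w "p # rs" "real k"] lenrs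
            vol.D_mset[of "p # real k *\<^sub>R w # rs" "real k *\<^sub>R w # p # rs"]
            vol.D_mset[of "w # p # rs" "p # w # rs"] by simp
        moreover have "set (p # real k *\<^sub>R w # rs) \<subseteq> \<Phi> (K k)"
          using p(1) kw rs(2) zero_sub[of k] by auto
        then have "vol (zonotope (p # real k *\<^sub>R w # rs)) \<le> real DIM('a) ^ DIM('a) * (cu * vol (K k))"
          using lenrs by (intro vol_image_ge cK) auto
        ultimately show ?thesis by (simp add: vol_D[symmetric] volK \<alpha>_def mult_ac del: simplex_sum.simps list.map)
      qed
      moreover have "0 < \<eta> / (u \<bullet> u) * W" using \<eta> W u(1) by simp
      ultimately show False using no_linear_square_bound by blast
    qed
  qed
qed

text \<open>Stretching one generator of a basis by k gives images of volume O(k). Two independent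
  vectors of growth would produce order k^2, so all of them lie on the line through v, and D is the
  support function of [-v, v]. Then \<open>D_proportional_vol\<close> passes from one basis to all
  parallelotopes.\<close>

lemma h_zonotope:
  obtains v where "0 < v \<bullet> u"
    "\<And>as x. length as \<le> DIM('a) \<Longrightarrow> h x (zonotope as) = h x {0} + vol (zonotope as) * \<bar>v \<bullet> x\<bar>"
proof -
  obtain e :: "'a list" where e: "basis_list e"
    using extend_to_basis_list[of "[]" UNIV] independent_empty by auto
  then obtain a e' where ae: "e = a # e'" using dim2 by (cases e) (auto simp: basis_list_def)
  have VB: "vanishing_below (h x) DIM('a) 0 (h x {0})" for x
    using h_zonotope_low by (intro vanishing_below.intro real_valuation_h h_nonneg) auto
  define V where "V = vol (zonotope e)"
  have V: "0 < V" unfolding V_def by (intro vol_zonotope_pos e)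
  define D where "D y = h y (zonotope e) - h y {0}" for y
  have D: "0 \<le> D y" "D (- y) = D y" for y using h_zero_le[of y e] by (auto simp: D_def h_uminus)
  define K where "K k = zonotope (real k *\<^sub>R a # e')" for k :: nat
  have cK: "convex_body (K k)" for k by (simp add: K_def del: simplex_sum.simps list.map)
  have zero_sub: "\<Phi> {0} \<subseteq> \<Phi> (K k)" for k unfolding K_def by (rule contains_zero_image)
  have hK: "h y (K k) = h y {0} + real k * D y" for y k
    using h_zonotope_scale[of "real k" y a e'] h_zonotope_low[of e' y] e by (simp add: K_def D_def ae basis_list_def)
  have volK: "vol (K k) = real k * V" for k
    using vol.D_scaleR[of a e' "real k"] e by (simp add: vol_D K_def V_def ae basis_list_def)
  have Du: "0 < D u" using h_u_pos[of e] V by (simp add: D_def V_def h_u_zero)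
  have point: "\<exists>w. w \<bullet> x = D x \<and> (\<forall>y. w \<bullet> y \<le> D y)" for x
    by (rule asymptotic_support_point[of "\<lambda>k. \<Phi> (K k)" "\<lambda>y. h y {0}" D x])
      (use hK h_nonneg cK in \<open>auto simp: h_def intro!: body\<close>)
  have mem: "real k *\<^sub>R w \<in> \<Phi> (K k)" if "\<And>y. w \<bullet> y \<le> D y" for w k
  proof (rule supp_mem[OF body[OF cK]])
    fix y
    show "real k *\<^sub>R w \<bullet> y \<le> supp (\<Phi> (K k)) y"
      using mult_left_mono[OF that[of y], of "real k"] hK[of y k] h_nonneg[of "{0}" y] by (simp add: h_def)
  qed
  obtain v where v: "v \<bullet> u = D u" "\<And>y. v \<bullet> y \<le> D y" using point[of u] by blast
  have Dv: "D x = \<bar>v \<bullet> x\<bar>" for x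
  proof -
    obtain w where w: "w \<bullet> x = D x" "\<And>y. w \<bullet> y \<le> D y" using point[of x] by blast
    have "w \<in> span {v}"
    proof (rule ccontr)
      assume wv: "w \<notin> span {v}"
      have v0: "v \<noteq> 0" using v(1) Du by auto
      have "independent (set [v, w])"
        using independent_insertI[OF wv] v0 by (simp add: insert_commute)
      moreover have "distinct [v, w]" using wv by (auto simp: span_base)
      moreover have "span (set [v, w] \<union> \<Phi> {0}) = UNIV"
        using v(1) Du by (intro span_with_transversal[of v]) (auto simp: inner_commute)
      ultimately obtain rs where rs: "basis_list ([v, w] @ rs)" "set rs \<subseteq> \<Phi> {0}"
        using extend_to_basis_list[of "[v, w]" "\<Phi> {0}"] by blast
      define W where "W = vol.D (v # w # rs)"
      have W: "0 < W" using vol_zonotope_pos[OF rs(1)] by (simp add: W_def vol_D)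
      have lenrs: "length (v # w # rs) = DIM('a)" using rs(1) by (simp add: basis_list_def)
      have "real k * (real k * W) \<le> real k * (real DIM('a) ^ DIM('a) * (cu * V))" for k
      proof -
        have "vol.D (map ((*\<^sub>R) (real k)) [v, w] @ rs) = real k ^ length [v, w] * W"
          unfolding W_def using vol.D_scaleR_list[of "[v, w]" rs "real k"] lenrs by simp
        moreover have "set (map ((*\<^sub>R) (real k)) [v, w] @ rs) \<subseteq> \<Phi> (K k)"
          using mem[OF v(2)] mem[OF w(2)] rs(2) zero_sub[of k] by auto
        then have "vol (zonotope (map ((*\<^sub>R) (real k)) [v, w] @ rs)) \<le> real DIM('a) ^ DIM('a) * (cu * vol (K k))"
          using lenrs by (intro vol_image_ge cK) auto
        ultimately show ?thesis
          unfolding vol_D[symmetric] by (simp add: volK mult_ac power2_eq_square)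
      qed
      then show False using no_linear_square_bound[OF W] by blast
    qed
    then obtain t where t: "w = t *\<^sub>R v" by (auto simp: span_singleton)
    \<comment> \<open>Test w at u and at -u; v attains D at u.\<close>
    have "\<bar>t\<bar> * D u \<le> 1 * D u"
    proof -
      have "t * D u \<le> D u" using w(2)[of u] t v(1) by simp
      moreover have "- (t * D u) \<le> D u" using w(2)[of "- u"] t v(1) D(2)[of u] by simp
      ultimately show ?thesis by (cases "0 \<le> t") auto
    qed
    then have "\<bar>t\<bar> \<le> 1" using Du mult_le_cancel_right_pos by blast
    moreover have "D x = t * (v \<bullet> x)" using w(1) t by simp
    then have "D x = \<bar>t\<bar> * \<bar>v \<bullet> x\<bar>" using D(1)[of x] by (metis abs_mult abs_of_nonneg)
    ultimately have "D x \<le> \<bar>v \<bullet> x\<bar>" using mult_right_mono[of "\<bar>t\<bar>" 1 "\<bar>v \<bullet> x\<bar>"] by simp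
    moreover have "\<bar>v \<bullet> x\<bar> \<le> D x" using v(2)[of x] v(2)[of "- x"] D(2)[of x] by auto
    ultimately show ?thesis by simp
  qed
  have main: "h x (zonotope as) = h x {0} + vol (zonotope as) * \<bar>((1 / V) *\<^sub>R v) \<bullet> x\<bar>"
    if as: "length as \<le> DIM('a)" for as x
  proof (cases "length as < DIM('a)")
    case True
    then show ?thesis using h_zonotope_low[OF True] vol_zonotope_low[OF True] by simp
  next
    case False
    then have "length as = DIM('a)" using as by simp
    from vanishing_below.D_proportional_vol[OF VB[of x] refl e this]
    have "(h x (zonotope as) - h x {0}) * V = D x * vol (zonotope as)"
      by (simp add: vanishing_below.D_def[OF VB[of x]] D_def V_def)
    then have "h x (zonotope as) - h x {0} = D x * vol (zonotope as) / V"
      using V by (simp add: eq_divide_eq)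
    then show ?thesis using V by (simp add: Dv abs_mult mult.commute)
  qed
  show thesis
  \<comment> \<open>So far v is the growth belonging to the parallelotope on e; dividing by V makes
    it the growth per unit volume.\<close>
  proof (rule that[of "(1 / V) *\<^sub>R v"])
    show "0 < (1 / V) *\<^sub>R v \<bullet> u" using v(1) Du V by simp
  qed (use main in blast)
qed

end

section \<open>From parallelotopes to all bodies\<close>

lemma doubling_powers:
  fixes F :: "real \<Rightarrow> real"
  assumes "\<And>r. 0 < r \<Longrightarrow> F (2 * r) = 2 * F r"
  shows "F (2 ^ m) = 2 ^ m * F 1" "F ((1 / 2) ^ m) = (1 / 2) ^ m * F 1"
proof -
  show "F (2 ^ m) = 2 ^ m * F 1" by (induction m) (use assms in auto)
  show "F ((1 / 2) ^ m) = (1 / 2) ^ m * F 1"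
  proof (induction m)
    case (Suc m)
    have "F (2 * (1 / 2) ^ Suc m) = 2 * F ((1 / 2) ^ Suc m)" by (intro assms) auto
    then show ?case using Suc by simp
  qed simp
qed

lemma nonneg_of_doubling_bounded_below:
  fixes F :: "real \<Rightarrow> real"
  assumes "\<And>r. 0 < r \<Longrightarrow> F (2 * r) = 2 * F r" and bdd: "\<And>r. 0 < r \<Longrightarrow> C \<le> F r"
  shows "0 \<le> F 1"
proof (rule ccontr)
  assume neg: "\<not> 0 \<le> F 1"
  obtain m :: nat where m: "C / F 1 < 2 ^ m" using real_arch_pow[of 2 "C / F 1"] by auto
  have "C \<le> 2 ^ m * F 1" using bdd[of "2 ^ m"] doubling_powers(1)[where F = F, OF assms(1), of m] by simp
  then show False using m neg by (simp add: neg_divide_less_eq)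
qed

text \<open>Going down, F 1 = 2^m F (2^-m) is at least -C 2^-m.\<close>

lemma nonneg_of_doubling_quadratic:
  fixes F :: "real \<Rightarrow> real"
  assumes "\<And>r. 0 < r \<Longrightarrow> F (2 * r) = 2 * F r"
    and bdd: "\<And>r. 0 < r \<Longrightarrow> r \<le> 1 \<Longrightarrow> - (C * r ^ 2) \<le> F r"
  shows "0 \<le> F 1"
proof (rule LIMSEQ_le_const2)
  show "(\<lambda>m. - (C * (1 / 2) ^ m)) \<longlonglongrightarrow> 0"
    using tendsto_minus[OF tendsto_mult_right_zero[OF LIMSEQ_power_zero[of "1 / 2 :: real"], of C]] by simp
  have "- (C * (1 / 2) ^ m) \<le> F 1" for m
  proof -
    define r where "r = (1 / 2 :: real) ^ m"
    have r: "0 < r" "r \<le> 1" by (auto simp: r_def power_le_one)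
    have "r * - (C * r) \<le> r * F 1"
      using bdd[OF r] doubling_powers(2)[where F = F, OF assms(1), of m] by (simp add: r_def power2_eq_square mult_ac)
    then show ?thesis using r(1) unfolding r_def by (simp only: mult_le_cancel_left_pos)
  qed
  then show "\<exists>N. \<forall>m\<ge>N. - (C * (1 / 2) ^ m) \<le> F 1" by blast
qed

context vc_valuation
begin

lemma h_valuation: "real_valuation (\<lambda>K. a * h x K + b * vol K + c)"
  by (intro real_valuation_lincomb real_valuation_h real_valuation_vol)

lemma h_simplex_sum_perp:
  assumes zon: "\<And>as. length as \<le> DIM('a) \<Longrightarrow> h x (zonotope as) = h x {0}"
    and "length (concat bss) \<le> DIM('a)"
  shows "h x (simplex_sum bss) = h x {0}"
proof -
  define f where "f K = 1 * h x K + 0 * vol K + (- h x {0})" for K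
  have "f (simplex_sum bss) = 0"
  proof (rule valuation_simplex_sum_eq_0[where n = "DIM('a)"])
    show "real_valuation f" unfolding f_def by (rule h_valuation)
    show "f (zonotope as) = 0" if "length as \<le> DIM('a)" for as using zon[OF that] by (simp add: f_def)
  next
    fix b :: "'a list" and bss :: "'a list list"
    assume dbl: "\<And>r. 0 < r \<Longrightarrow> f (simplex_sum (map ((*\<^sub>R) (2 * r)) b # bss)) = 2 * f (simplex_sum (map ((*\<^sub>R) r) b # bss))"
    define F where "F r = f (simplex_sum (map ((*\<^sub>R) r) b # bss))" for r
    have "- h x {0} \<le> F r" for r
      using h_nonneg[of "simplex_sum (map ((*\<^sub>R) r) b # bss)" x] by (simp add: F_def f_def)
    then have "0 \<le> F 1"
      using dbl unfolding F_def[symmetric] by (intro nonneg_of_doubling_bounded_below[of F "- h x {0}"]) auto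
    then show "0 \<le> f (simplex_sum (b # bss))" by (simp add: F_def map_idI)
  qed fact
  then show ?thesis by (simp add: f_def)
qed

lemma h_simplex_sum_normal:
  assumes zon: "\<And>as. length as \<le> DIM('a) \<Longrightarrow> h u (zonotope as) = \<kappa> * vol (zonotope as)"
    and \<kappa>: "0 \<le> \<kappa>" and "length (concat bss) \<le> DIM('a)"
  shows "h u (simplex_sum bss) = \<kappa> * vol (simplex_sum bss)"
proof -
  define f where "f K = 1 * h u K + (- \<kappa>) * vol K + 0" for K
  have "f (simplex_sum bss) = 0"
  proof (rule valuation_simplex_sum_eq_0[where n = "DIM('a)"])
    show "real_valuation f" unfolding f_def by (rule h_valuation)
    show "f (zonotope as) = 0" if "length as \<le> DIM('a)" for as using zon[OF that] by (simp add: f_def)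
  next
    fix b :: "'a list" and bss :: "'a list list"
    assume len: "2 \<le> length b" "length b + length (concat bss) \<le> DIM('a)"
    assume dbl: "\<And>r. 0 < r \<Longrightarrow> f (simplex_sum (map ((*\<^sub>R) (2 * r)) b # bss)) = 2 * f (simplex_sum (map ((*\<^sub>R) r) b # bss))"
    define F where "F r = f (simplex_sum (map ((*\<^sub>R) r) b # bss))" for r
    define W where "W = vol (zonotope (b @ concat bss))"
    \<comment> \<open>The scaled block has at least two vectors, so the volume shrinks at least like
      r^2, faster than the linear rate forced by doubling.\<close>
    have "- (\<kappa> * W * r ^ 2) \<le> F r" if r: "0 < r" "r \<le> 1" for r
    proof -
      define bs where "bs = map ((*\<^sub>R) r) b # bss"
      have "vol (simplex_sum bs) \<le> vol (zonotope (concat bs))"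
        by (intro vol_mono simplex_sum_subset_zonotope) auto
      also have "\<dots> \<le> r ^ 2 * W"
      proof (cases "length b + length (concat bss) = DIM('a)")
        case True
        have "vol (zonotope (concat bs)) = r ^ length b * W"
          using vol.D_scaleR_list[OF True, of r] r by (simp add: vol_D bs_def W_def)
        also have "\<dots> \<le> r ^ 2 * W"
          using r len(1) by (intro mult_right_mono power_decreasing) (auto simp: W_def)
        finally show ?thesis .
      next
        case False
        then have "vol (zonotope (concat bs)) = 0"
          using len(2) by (intro vol_zonotope_low) (simp add: bs_def)
        then show ?thesis by (simp add: W_def)
      qed
      finally have "\<kappa> * vol (simplex_sum bs) \<le> \<kappa> * (r ^ 2 * W)" using \<kappa> by (intro mult_left_mono)
      moreover have "0 \<le> h u (simplex_sum bs)" by (intro h_nonneg) auto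
      ultimately show ?thesis by (simp add: F_def f_def bs_def[symmetric] mult_ac del: simplex_sum.simps)
    qed
    then have "0 \<le> F 1"
      using dbl unfolding F_def[symmetric] by (intro nonneg_of_doubling_quadratic[of F "\<kappa> * W"]) auto
    then show "0 \<le> f (simplex_sum (b # bss))" by (simp add: F_def map_idI)
  qed fact
  then show ?thesis by (simp add: f_def)
qed

text \<open>Project y along v to y' = y - t v in the hyperplane. Every z has a z' = z - s u
  orthogonal to v, and then y' . z = y . z' <= h z' {0} <= h z {0}; so y' lies in the image of {0}.
  The direction u gives |t| <= r.\<close>

lemma h_le_cylinder:
  assumes K: "convex_body K" and v: "0 < v \<bullet> u"
    and perp: "\<And>z. v \<bullet> z = 0 \<Longrightarrow> h z K = h z {0}"
    and normal: "h u K = r * (v \<bullet> u)"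
  shows "h x K \<le> h x {0} + r * \<bar>v \<bullet> x\<bar>"
proof -
  obtain y where y: "y \<in> \<Phi> K" "y \<bullet> x = h x K"
    unfolding h_def by (rule supp_attained[OF body[OF K]])
  have y_le: "y \<bullet> z \<le> h z K" for z unfolding h_def by (intro supp_ge body K y(1))
  define t where "t = (y \<bullet> u) / (v \<bullet> u)"
  define y' where "y' = y - t *\<^sub>R v"
  have "u \<bullet> y' = 0" using v by (simp add: y'_def t_def inner_diff_right inner_commute[of u])
  have "y' \<in> \<Phi> {0}"
  proof (rule supp_mem[OF body])
    fix z
    define s where "s = (v \<bullet> z) / (v \<bullet> u)"
    define z' where "z' = z - s *\<^sub>R u"
    have vz: "v \<bullet> z' = 0" using v by (simp add: z'_def s_def inner_diff_right)
    have "y' \<bullet> z = y' \<bullet> z'" using \<open>u \<bullet> y' = 0\<close> by (simp add: z'_def inner_diff_right inner_commute[of y' u])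
    also have "\<dots> = y \<bullet> z'" using vz by (simp add: y'_def inner_diff_left)
    also have "\<dots> \<le> h z' {0}" using y_le[of z'] perp[OF vz] by simp
    also have "\<dots> \<le> supp (\<Phi> {0}) z"
      unfolding h_def
    proof (rule supp_le)
      fix q assume q: "q \<in> \<Phi> {0}"
      then have "q \<in> span (\<Phi> {0})" by (rule span_base)
      then have "q \<bullet> z' = q \<bullet> z" using u(2) by (simp add: z'_def inner_diff_right inner_commute[of q u])
      then show "q \<bullet> z' \<le> supp (\<Phi> {0}) z" using supp_ge[OF body q] by simp
    qed (use body[of "{0}"] in \<open>simp add: convex_body_def\<close>)
    finally show "y' \<bullet> z \<le> supp (\<Phi> {0}) z" .
  qed simp
  then have "y' \<bullet> x \<le> h x {0}" unfolding h_def by (intro supp_ge body) auto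
  moreover have "t * (v \<bullet> x) \<le> r * \<bar>v \<bullet> x\<bar>"
  proof -
    have "\<bar>y \<bullet> u\<bar> \<le> r * (v \<bullet> u)"
      using y_le[of u] y_le[of "- u"] normal h_uminus[OF K, of u] by auto
    then have "\<bar>t\<bar> \<le> r" using v by (simp add: t_def abs_div_pos[symmetric] divide_le_eq)
    then have "\<bar>t\<bar> * \<bar>v \<bullet> x\<bar> \<le> r * \<bar>v \<bullet> x\<bar>" by (intro mult_right_mono) auto
    then show ?thesis using abs_ge_self[of "t * (v \<bullet> x)"] by (simp add: abs_mult)
  qed
  ultimately show ?thesis using y(2) by (simp add: y'_def inner_diff_left)
qed

lemma h_polytope:
  obtains v where "0 < v \<bullet> u"
    "\<And>V x. finite V \<Longrightarrow> V \<noteq> {} \<Longrightarrow> h x (convex hull V) = h x {0} + vol (convex hull V) * \<bar>v \<bullet> x\<bar>"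
proof -
  obtain v where v: "0 < v \<bullet> u"
    and zon: "\<And>as x. length as \<le> DIM('a) \<Longrightarrow> h x (zonotope as) = h x {0} + vol (zonotope as) * \<bar>v \<bullet> x\<bar>"
    using h_zonotope by blast
  have le: "h x (simplex_sum bss) \<le> h x {0} + vol (simplex_sum bss) * \<bar>v \<bullet> x\<bar>"
    if len: "length (concat bss) \<le> DIM('a)" for bss x
  proof (rule h_le_cylinder[OF _ v])
    show "h z (simplex_sum bss) = h z {0}" if "v \<bullet> z = 0" for z
      using zon[of _ z] that by (intro h_simplex_sum_perp[OF _ len]) simp
    have "h u (zonotope as) = (v \<bullet> u) * vol (zonotope as)" if "length as \<le> DIM('a)" for as
      using zon[OF that, of u] v by (simp add: h_u_zero)
    then have "h u (simplex_sum bss) = (v \<bullet> u) * vol (simplex_sum bss)"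
      using v by (intro h_simplex_sum_normal[OF _ _ len]) simp_all
    then show "h u (simplex_sum bss) = vol (simplex_sum bss) * (v \<bullet> u)" by simp
  qed simp
  have eq: "h x (simplex_sum bss) = h x {0} + vol (simplex_sum bss) * \<bar>v \<bullet> x\<bar>"
    if "length (concat bss) \<le> DIM('a)" for bss x
  proof -
    \<comment> \<open>The support value enters with a minus sign, so that \<open>le\<close> is the
      required nonnegativity.\<close>
    define f where "f K = (- 1) * h x K + \<bar>v \<bullet> x\<bar> * vol K + h x {0}" for K
    have "f (simplex_sum bss) = 0"
    proof (rule valuation_simplex_sum_eq_0[where n = "DIM('a)"])
      show "real_valuation f" unfolding f_def by (rule h_valuation)
      show "f (zonotope as) = 0" if "length as \<le> DIM('a)" for as
        using zon[OF that, of x] by (simp add: f_def mult.commute)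
      show "0 \<le> f (simplex_sum (b # bss))" if "length b + length (concat bss) \<le> DIM('a)" for b bss
        using le[of "b # bss" x] that by (simp add: f_def mult.commute)
    qed fact
    then show ?thesis by (simp add: f_def mult.commute)
  qed
  show thesis
  proof (rule that[OF v])
    fix V :: "'a set" and x assume V: "finite V" "V \<noteq> {}"
    define f where "f K = 1 * h x K + (- \<bar>v \<bullet> x\<bar>) * vol K + (- h x {0})" for K
    have "f (convex hull V) = 0"
    proof (rule valuation_polytope_eq_0[OF _ _ V])
      show "real_valuation f" unfolding f_def by (rule h_valuation)
      show "f (path_simplex bs) = 0" if "length bs \<le> DIM('a)" for bs
        using eq[of "[bs]" x] that by (simp add: f_def mult.commute)
    qed
    then show "h x (convex hull V) = h x {0} + vol (convex hull V) * \<bar>v \<bullet> x\<bar>"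
      by (simp add: f_def mult.commute)
  qed
qed

end

section \<open>Outer approximation by polytopes; volume of cylinders\<close>

lemma outer_polytope:
  fixes K :: "'a::euclidean_space set"
  assumes K: "convex_body K" and d: "0 < d"
  obtains V where "finite V" "V \<noteq> {}" "K \<subseteq> convex hull V" "convex hull V \<subseteq> K \<oplus> cball 0 d"
proof -
  \<comment> \<open>A cube of half-edge d / n lies within l1-distance d, hence Euclidean distance d,
    of its centre.\<close>
  define \<delta> where "\<delta> = d / DIM('a)"
  have \<delta>: "0 < \<delta>" using d by (simp add: \<delta>_def)
  have "\<exists>S. finite S \<and> ball x \<delta> \<subseteq> convex hull S \<and> convex hull S \<subseteq> cball x d" for x :: 'a
  proof -
    obtain S where S: "finite S" "cbox (x - (\<Sum>i\<in>Basis. \<delta> *\<^sub>R i)) (x + (\<Sum>i\<in>Basis. \<delta> *\<^sub>R i)) = convex hull S"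
      using cube_convex_hull[OF \<delta>, of x] by blast
    have box: "y \<in> convex hull S \<longleftrightarrow> (\<forall>i\<in>Basis. \<bar>(y - x) \<bullet> i\<bar> \<le> \<delta>)" for y
      unfolding S(2)[symmetric] mem_box
      by (rule ball_cong) (auto simp: inner_diff_left inner_add_left inner_sum_left_Basis abs_le_iff algebra_simps)
    have "ball x \<delta> \<subseteq> convex hull S"
    proof
      fix y assume "y \<in> ball x \<delta>"
      then have "norm (y - x) \<le> \<delta>" by (simp add: dist_norm norm_minus_commute)
      then show "y \<in> convex hull S" unfolding box using Basis_le_norm order_trans by blast
    qed
    moreover have "convex hull S \<subseteq> cball x d"
    proof
      fix y assume "y \<in> convex hull S"
      then have "(\<Sum>i\<in>Basis. \<bar>(y - x) \<bullet> i\<bar>) \<le> (\<Sum>i\<in>(Basis :: 'a set). \<delta>)"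
        unfolding box by (intro sum_mono) auto
      also have "\<dots> = d" by (simp add: \<delta>_def)
      finally have "norm (y - x) \<le> d" using norm_le_l1[of "y - x"] by linarith
      then show "y \<in> cball x d" by (simp add: dist_norm norm_minus_commute)
    qed
    ultimately show ?thesis using S(1) by blast
  qed
  then have "\<forall>x::'a. \<exists>S. finite S \<and> ball x \<delta> \<subseteq> convex hull S \<and> convex hull S \<subseteq> cball x d"
    by blast
  from choice[OF this] obtain S where
    S: "finite (S x)" "ball x \<delta> \<subseteq> convex hull S x" "convex hull S x \<subseteq> cball x d" for x :: 'a
    by blast
  have "compact K" using K by (simp add: convex_body_def)
  moreover have "open (ball x \<delta>)" if "x \<in> K" for x by (rule open_ball)
  moreover have "K \<subseteq> (\<Union>x\<in>K. ball x \<delta>)" using \<delta> by auto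
  ultimately obtain X where X: "X \<subseteq> K" "finite X" "K \<subseteq> (\<Union>x\<in>X. ball x \<delta>)"
    by (rule compactE_image[of K K "\<lambda>x. ball x \<delta>"])
  define V where "V = (\<Union>x\<in>X. S x)"
  have sub: "convex hull S x \<subseteq> convex hull V" if "x \<in> X" for x
    using that by (intro hull_mono) (auto simp: V_def)
  have 1: "K \<subseteq> convex hull V" using X(3) S(2) sub by blast
  have 2: "convex hull V \<subseteq> K \<oplus> cball 0 d"
  proof (rule hull_minimal)
    show "V \<subseteq> K \<oplus> cball 0 d"
    proof
      fix y assume "y \<in> V"
      then obtain x where x: "x \<in> X" "y \<in> S x" by (auto simp: V_def)
      then have "y \<in> cball x d" using S(3) hull_inc by fast
      then have "y - x \<in> cball 0 d" by (simp add: dist_norm norm_minus_commute)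
      then show "y \<in> K \<oplus> cball 0 d" using msumI[of x K "y - x" "cball 0 d"] x X(1) by auto
    qed
    have "convex_body (cball 0 d :: 'a set)" using d by (simp add: convex_body_def)
    then show "convex (K \<oplus> cball 0 d)" using convex_body_msum[OF K] by (simp add: convex_body_def)
  qed
  have "V \<noteq> {}" using 1 K by (auto simp: convex_body_def)
  moreover have "finite V" using X S by (auto simp: V_def)
  ultimately show thesis using that 1 2 by blast
qed

lemma hausdist_le_of_outer:
  assumes K: "convex_body K" and P: "K \<subseteq> P" "P \<subseteq> K \<oplus> cball 0 d" and d: "0 \<le> d"
  shows "hausdist K P \<le> d"
proof -
  have K0: "K \<noteq> {}" using K by (simp add: convex_body_def)
  have "infdist x P \<le> d" if "x \<in> K" for x
    using that P(1) d by (simp add: subset_iff)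
  moreover have "infdist y K \<le> d" if "y \<in> P" for y
  proof -
    obtain x b where "x \<in> K" "norm b \<le> d" "y = x + b" using P(2) \<open>y \<in> P\<close> by (force simp: msum_def)
    then show ?thesis using infdist_le2[of x K y d] by (simp add: dist_norm)
  qed
  ultimately show ?thesis
    unfolding hausdist_def using K0 P(1) by (auto intro!: cSUP_least)
qed

lemma supp_le_hausdist:
  assumes A: "convex_body A" and B: "convex_body B" and d: "hausdist A B < e"
  shows "supp A x \<le> supp B x + e * norm x"
proof -
  obtain a where a: "a \<in> A" "a \<bullet> x = supp A x" using supp_attained[OF A] .
  \<comment> \<open>Only for a bounded family does the real supremum in \<open>hausdist\<close>
    bound the distance of a single point.\<close>
  have "bdd_above ((\<lambda>x. infdist x B) ` A)"
    using A by (intro bounded_imp_bdd_above compact_imp_bounded compact_continuous_image)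
      (auto simp: convex_body_def intro: continuous_intros)
  then have "infdist a B \<le> (SUP x\<in>A. infdist x B)" using a(1) by (intro cSUP_upper)
  also have "\<dots> < e" using d by (simp add: hausdist_def)
  finally have "infdist a B < e" .
  moreover obtain b where "b \<in> B" "infdist a B = dist a b"
    using infdist_attains_inf[of B a] B compact_imp_closed by (auto simp: convex_body_def)
  ultimately have b: "b \<in> B" "norm (a - b) \<le> e" by (auto simp: dist_norm)
  have "(a - b) \<bullet> x \<le> e * norm x"
    using norm_cauchy_schwarz[of "a - b" x] mult_right_mono[OF b(2), of "norm x"] by simp
  then show ?thesis using supp_ge[OF B b(1), of x] a(2) by (simp add: inner_diff_left)
qed

lemma hausdist_commute: "hausdist A B = hausdist B A"
  by (simp add: hausdist_def max.commute)

lemma supp_diff_hausdist: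
  "convex_body A \<Longrightarrow> convex_body B \<Longrightarrow> hausdist A B < e \<Longrightarrow> \<bar>supp A x - supp B x\<bar> \<le> e * norm x"
  using supp_le_hausdist[of A B e x] supp_le_hausdist[of B A e x]
  by (simp add: hausdist_commute abs_le_iff)

text \<open>Approximating from outside squeezes the volumes between that of K and those of the
  parallel bodies A m. These decrease to K, so continuity of measure from above applies.\<close>

lemma polytope_approximation:
  fixes K :: "'a::euclidean_space set"
  assumes K: "convex_body K"
  obtains V where "\<And>m::nat. finite (V m)" "\<And>m. V m \<noteq> {}"
    "(\<lambda>m. hausdist K (convex hull V m)) \<longlonglongrightarrow> 0" "(\<lambda>m. vol (convex hull V m)) \<longlonglongrightarrow> vol K"
proof -
  define d where "d m = 1 / real (Suc m)" for m
  have d: "0 < d m" for m by (simp add: d_def)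
  define A where "A m = K \<oplus> cball 0 (d m)" for m
  have "\<exists>V. finite V \<and> V \<noteq> {} \<and> K \<subseteq> convex hull V \<and> convex hull V \<subseteq> A m" for m
    using outer_polytope[OF K d[of m]] unfolding A_def by metis
  then obtain V where V: "\<And>m. finite (V m)" "\<And>m. V m \<noteq> {}" "\<And>m. K \<subseteq> convex hull V m" "\<And>m. convex hull V m \<subseteq> A m"
    by metis
  have bodyA: "convex_body (A m)" for m
    using K d[of m] unfolding A_def by (intro convex_body_msum) (auto simp: convex_body_def)
  have bodyV: "convex_body (convex hull V m)" for m using V by (intro convex_body_hull)
  have d0: "d \<longlonglongrightarrow> 0" unfolding d_def by (rule LIMSEQ_Suc, rule lim_1_over_n)
  have "hausdist K (convex hull V m) \<le> d m" for m
    using V d[of m] by (intro hausdist_le_of_outer K) (auto simp: A_def)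
  moreover have "0 \<le> hausdist K (convex hull V m)" for m
  proof -
    obtain x where "x \<in> K" using K by (auto simp: convex_body_def)
    have "bdd_above ((\<lambda>x. infdist x (convex hull V m)) ` K)"
      using K by (intro bounded_imp_bdd_above compact_imp_bounded compact_continuous_image)
        (auto simp: convex_body_def intro: continuous_intros)
    then have "infdist x (convex hull V m) \<le> (SUP x\<in>K. infdist x (convex hull V m))"
      using \<open>x \<in> K\<close> by (intro cSUP_upper)
    then show ?thesis unfolding hausdist_def using infdist_nonneg[of x "convex hull V m"] by linarith
  qed
  ultimately have haus: "(\<lambda>m. hausdist K (convex hull V m)) \<longlonglongrightarrow> 0"
    by (intro tendsto_sandwich[OF _ _ tendsto_const d0]) auto
  have "(\<Inter>m. A m) = K"
  proof
    show "(\<Inter>m. A m) \<subseteq> K"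
    proof
      fix y assume y: "y \<in> (\<Inter>m. A m)"
      have "infdist y K \<le> d m" for m
      proof -
        obtain x b where "x \<in> K" "norm b \<le> d m" "y = x + b" using y by (force simp: A_def msum_def)
        then show ?thesis using infdist_le2[of x K y "d m"] by (simp add: dist_norm)
      qed
      then have "infdist y K \<le> 0" using LIMSEQ_le_const[OF d0] by blast
      then show "y \<in> K"
        using K in_closed_iff_infdist_zero[of K y] infdist_nonneg[of y K]
        by (simp add: convex_body_def compact_imp_closed)
    qed
    show "K \<subseteq> (\<Inter>m. A m)" using V(3,4) by blast
  qed
  moreover have "decseq A"
    unfolding decseq_Suc_iff A_def
    by (intro allI msum_mono subset_cball) (auto simp: d_def frac_le)
  then have "(\<lambda>m. measure lebesgue (A m)) \<longlonglongrightarrow> measure lebesgue (\<Inter>m. A m)"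
    using fmeasurableD[OF convex_body_lmeasurable[OF bodyA]] fmeasurableD2[OF convex_body_lmeasurable[OF bodyA]]
    by (intro Lim_measure_decseq) auto
  ultimately have "(\<lambda>m. vol (A m)) \<longlonglongrightarrow> vol K" by (simp add: vol_def)
  moreover have bounds: "vol K \<le> vol (convex hull V m)" "vol (convex hull V m) \<le> vol (A m)" for m
    using V(3,4) by (auto intro!: vol_mono K bodyV bodyA)
  ultimately have "(\<lambda>m. vol (convex hull V m)) \<longlonglongrightarrow> vol K"
    using tendsto_sandwich[of "\<lambda>_. vol K" "\<lambda>m. vol (convex hull V m)" sequentially "\<lambda>m. vol (A m)" "vol K"]
    by simp
  then show thesis using that[of V] V(1,2) haus by simp
qed

text \<open>Since L has volume 0, the affine dependence on the length of the added segment is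
  linear. The segment [-w, w] is a translate of [0, 2 w].\<close>

lemma vol_cylinder:
  fixes L :: "'a::euclidean_space set"
  assumes L: "convex_body L" "vol L = 0" and r: "0 \<le> r"
  shows "vol (L \<oplus> ((\<lambda>x. r *\<^sub>R x) ` closed_segment (- v) v)) = r * vol (L \<oplus> closed_segment (- v) v)"
proof -
  have seg: "closed_segment (- w) w = closed_segment 0 (2 *\<^sub>R w) \<oplus> {- w}" for w :: 'a
    using closed_segment_translation[of "- w" 0 "2 *\<^sub>R w"]
    by (simp add: msum_singleton scaleR_2 add.commute)
  have shift: "vol (L \<oplus> closed_segment (- w) w) = vol (L \<oplus> closed_segment 0 (2 *\<^sub>R w))" for w
    using real_valuation_translation[OF real_valuation_vol, of "L \<oplus> closed_segment 0 (2 *\<^sub>R w)"] L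
    by (simp add: seg msum_assoc)
  show ?thesis
    using valuation_add_segment(1)[OF real_valuation_vol vol_nonneg L(1) r, of "2 *\<^sub>R v"] L(2)
    by (simp add: scaled_segment shift mult.commute[of r])
qed

theorem theorem5p3:
  fixes \<Phi> :: "'a::euclidean_space set \<Rightarrow> 'a set"
  assumes "DIM('a) \<ge> 2"
    and "\<forall>K. convex_body K \<longrightarrow> convex_body (\<Phi> K)"
    and "minkowski_valuation \<Phi>"
    and "hausdorff_continuous \<Phi>"
    and "translation_invariant \<Phi>"
    and "\<forall>K. convex_body K \<longrightarrow> origin_symmetric (\<Phi> K)"
  shows "(VC \<Phi> \<and> aff_dim (\<Phi> {0}) = int DIM('a) - 1) \<longleftrightarrow>
         (\<exists>L v. convex_body L \<and> origin_symmetric L \<and> aff_dim L = int DIM('a) - 1 \<and>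
                aff_dim (L \<oplus> closed_segment (-v) v) = int DIM('a) \<and>
                (\<forall>K. convex_body K \<longrightarrow>
                   \<Phi> K = L \<oplus> ((\<lambda>x. vol K *\<^sub>R x) ` closed_segment (-v) v)))"
proof
  assume lhs: "VC \<Phi> \<and> aff_dim (\<Phi> {0}) = int DIM('a) - 1"
  have images: "convex_body (\<Phi> K)" "origin_symmetric (\<Phi> K)" if "convex_body K" for K
    using assms that by auto
  obtain c C where VC: "0 < c" "\<And>K. convex_body K \<Longrightarrow> c * vol K \<le> vol (\<Phi> K)"
    "\<And>K. convex_body K \<Longrightarrow> vol (\<Phi> K) \<le> C * vol K"
    using lhs by (auto simp: VC_def)
  have "0 \<in> \<Phi> {0}" by (intro origin_symmetric_zero images) simp_all
  then obtain u where u: "u \<noteq> 0" "span (\<Phi> {0}) = {x. u \<bullet> x = 0}"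
    using hyperplane_contains lhs by blast
  interpret vc_valuation \<Phi> c C u
    by (rule vc_valuation.intro) (simp_all add: assms VC u)
  obtain v where v: "0 < v \<bullet> u" and poly: "\<And>V x. finite V \<Longrightarrow> V \<noteq> {} \<Longrightarrow>
      h x (convex hull V) = h x {0} + vol (convex hull V) * \<bar>v \<bullet> x\<bar>"
    using h_polytope by blast
  have hK: "h x K = h x {0} + vol K * \<bar>v \<bullet> x\<bar>" if K: "convex_body K" for K x
  proof -
    obtain V where V: "\<And>m::nat. finite (V m)" "\<And>m. V m \<noteq> {}"
      "(\<lambda>m. hausdist K (convex hull V m)) \<longlonglongrightarrow> 0" "(\<lambda>m. vol (convex hull V m)) \<longlonglongrightarrow> vol K"
      using polytope_approximation[OF K] by blast
    have bodyV: "convex_body (convex hull V m)" for m using V by (intro convex_body_hull)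
    have "(\<lambda>m. h x (convex hull V m)) \<longlonglongrightarrow> h x K"
    proof (rule LIMSEQ_I)
      fix e :: real assume e: "0 < e"
      \<comment> \<open>The added 1 covers x = 0.\<close>
      define e' where "e' = e / (norm x + 1)"
      have n: "0 < norm x + 1" using norm_ge_zero[of x] by linarith
      then have "0 < e'" "e' * (norm x + 1) = e" using e by (simp_all add: e'_def)
      then have e': "0 < e'" "e' * norm x < e" by (simp_all add: distrib_left)
      obtain d where d: "0 < d" "\<And>M. convex_body M \<Longrightarrow> hausdist K M < d \<Longrightarrow> hausdist (\<Phi> K) (\<Phi> M) < e'"
        using assms(4)[unfolded hausdorff_continuous_def, rule_format, OF K e'(1)] by blast
      have "eventually (\<lambda>m. hausdist K (convex hull V m) < d) sequentially"
        using order_tendstoD(2)[OF V(3) d(1)] .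
      then obtain N where "\<And>m. N \<le> m \<Longrightarrow> hausdist K (convex hull V m) < d"
        by (auto simp: eventually_sequentially)
      then have "\<bar>h x K - h x (convex hull V m)\<bar> \<le> e' * norm x" if "N \<le> m" for m
        unfolding h_def using that by (intro supp_diff_hausdist images d(2) K bodyV)
      then show "\<exists>N. \<forall>m\<ge>N. norm (h x (convex hull V m) - h x K) < e"
        using e'(2) by (metis abs_minus_commute order_le_less_trans real_norm_def)
    qed
    moreover have "(\<lambda>m. h x (convex hull V m)) \<longlonglongrightarrow> h x {0} + vol K * \<bar>v \<bullet> x\<bar>"
      using tendsto_add[OF tendsto_const tendsto_mult_right[OF V(4)]] V(1,2) by (simp add: poly)
    ultimately show ?thesis by (rule LIMSEQ_unique)
  qed
  define L where "L = \<Phi> {0}"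
  have L: "convex_body L" "origin_symmetric L" by (simp_all add: L_def images)
  have repr: "\<Phi> K = L \<oplus> ((\<lambda>x. vol K *\<^sub>R x) ` closed_segment (-v) v)" if K: "convex_body K" for K
  proof (rule supp_eqI)
    show "supp (\<Phi> K) x = supp (L \<oplus> (\<lambda>x. vol K *\<^sub>R x) ` closed_segment (- v) v) x" for x
      using hK[OF K, of x] L(1) by (simp add: scaled_segment supp_msum supp_segment h_def L_def abs_mult)
  qed (use K L(1) images in \<open>auto simp: scaled_segment\<close>)
  have volL: "vol L = 0" using vol_eq_0_iff[OF L(1)] lhs by (simp add: L_def)
  \<comment> \<open>Otherwise every image would have volume 0, against the lower bound in (VC) for a
    parallelotope.\<close>
  have "vol (L \<oplus> closed_segment (- v) v) \<noteq> 0"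
  proof
    assume 0: "vol (L \<oplus> closed_segment (- v) v) = 0"
    obtain e :: "'a list" where e: "basis_list e"
      using extend_to_basis_list[of "[]" UNIV] independent_empty by auto
    have "vol (\<Phi> (zonotope e)) = 0"
      using repr[of "zonotope e"] vol_cylinder[OF L(1) volL, of "vol (zonotope e)" v] 0 by simp
    then show False
      using VC(2)[of "zonotope e"] mult_pos_pos[OF VC(1) vol_zonotope_pos[OF e]] by simp
  qed
  then have "aff_dim (L \<oplus> closed_segment (- v) v) = int DIM('a)"
    using vol_eq_0_iff[of "L \<oplus> closed_segment (- v) v"] L(1) by auto
  then show "\<exists>L v. convex_body L \<and> origin_symmetric L \<and> aff_dim L = int DIM('a) - 1 \<and>
                aff_dim (L \<oplus> closed_segment (-v) v) = int DIM('a) \<and>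
                (\<forall>K. convex_body K \<longrightarrow> \<Phi> K = L \<oplus> ((\<lambda>x. vol K *\<^sub>R x) ` closed_segment (-v) v))"
    using L lhs repr unfolding L_def by blast
next
  assume "\<exists>L v. convex_body L \<and> origin_symmetric L \<and> aff_dim L = int DIM('a) - 1 \<and>
                aff_dim (L \<oplus> closed_segment (-v) v) = int DIM('a) \<and>
                (\<forall>K. convex_body K \<longrightarrow> \<Phi> K = L \<oplus> ((\<lambda>x. vol K *\<^sub>R x) ` closed_segment (-v) v))"
  then obtain L v where L: "convex_body L" "aff_dim L = int DIM('a) - 1"
    "aff_dim (L \<oplus> closed_segment (-v) v) = int DIM('a)"
    and repr: "\<And>K. convex_body K \<Longrightarrow> \<Phi> K = L \<oplus> ((\<lambda>x. vol K *\<^sub>R x) ` closed_segment (-v) v)"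
    by blast
  define W where "W = vol (L \<oplus> closed_segment (-v) v)"
  have "W \<noteq> 0" using vol_eq_0_iff[of "L \<oplus> closed_segment (-v) v"] L by (auto simp: W_def)
  then have W: "0 < W" by (simp add: W_def order_less_le)
  have volL: "vol L = 0" using vol_eq_0_iff[OF L(1)] L(2) by simp
  \<comment> \<open>Volumes are multiplied by exactly W, so W serves as both constants in
    (VC).\<close>
  have "vol (\<Phi> K) = W * vol K" if "convex_body K" for K
    using repr[OF that] vol_cylinder[OF L(1) volL, of "vol K" v] by (simp add: W_def)
  then have "VC \<Phi>" unfolding VC_def using W by (intro exI[of _ W]) auto
  \<comment> \<open>A point has volume 0, so the segment term collapses and the image of {0} is
    L.\<close>
  moreover have "vol {0 :: 'a} = 0" by (simp add: vol_def)
  then have "\<Phi> {0} = L" using repr[of "{0}"] by (simp add: image_constant_conv)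
  ultimately show "VC \<Phi> \<and> aff_dim (\<Phi> {0}) = int DIM('a) - 1" using L(2) by simp
qed

end
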